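(* Let $X$ be a compact metric space and $T\colon X\to X$ continuous. Let $(\mu_n)_{n=1}^\infty$ be a sequence of $T$-invariant Borel probability measures on $X$ such that either every $\mu_n$ is a periodic measure, or every $\mu_n$ is loosely Kronecker. Let $\mu$ be a $\overline{\mathit{fk}}$-limit of $(\mu_n)_{n=1}^\infty$. If $\mu$ is aperiodic, then $\mu$ is loosely Kronecker.
   Context: Let $\rho$ be the metric of $X$. $X^\infty$ is the set of $X$-valued sequences indexed by $\mathbb N\cup\{0\}$; the trajectory of $x\in X$ is $\underline{x}_T=(T^j(x))_{j\ge0}\in X^\infty$. Feldman–Katok pseudometric: for $\underline x=(x_j),\underline z=(z_j)\in X^\infty$, $\delta>0$, $n\in\mathbb N$, an $(n,\delta)$-match is an order-preserving bijection $\pi\colon\mathcal D(\pi)\to\mathcal R(\pi)$ with $\mathcal D(\pi),\mathcal R(\pi)\subset\{0,\dots,n-1\}$ (possibly empty) and $\rho(x_i,z_{\pi(i)})<\delta$ for all $i\in\mathcal D(\pi)$; $|\pi|=|\mathcal D(\pi)|$. Put $\bar f_{n,\delta}(\underline x,\underline z)=1-\frac1n\max\{|\pi|:\pi\text{ is an }(n,\delta)\text{-match}\}$, $\bar f_\delta(\underline x,\underline z)=\limsup_{n\to\infty}\bar f_{n,\delta}(\underline x,\underline z)$, and $\overline{\mathit{fk}}(\underline x,\underline z)=\inf\{\delta>0:\bar f_\delta(\underline x,\underline z)<\delta\}$. For $x,z\in X$, $\overline{\mathit{fk}}(x,z)=\overline{\mathit{fk}}(\underline x_T,\underline z_T)$.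 A sequence $\underline x\in X^\infty$ is generic for a Borel probability measure $\mu$ if $\frac1n\sum_{j=0}^{n-1}\delta_{x_j}\to\mu$ weak$^*$; a point $x$ is generic for $\mu$ if $\underline x_T$ is. A quasi-orbit is $\underline z\in X^\infty$ such that $\{n\ge0:z_{n+1}\ne T(z_n)\}$ has upper asymptotic density $0$. $\overline{\mathit{fk}}$-limit: $\mu$ is a $\overline{\mathit{fk}}$-limit of $(\mu_n)$ if there are points $x^{(n)}\in X$ generic for $\mu_n$ such that $(x^{(n)})$ is a Cauchy sequence for $\overline{\mathit{fk}}$ on $X$, and $\mu$ is the $T$-invariant measure determined by this sequence, i.e. the (unique) measure having a generic quasi-orbit $\underline z$ with $\overline{\mathit{fk}}(\underline z,\underline x^{(n)}_T)\to0$. A periodic measure is the uniform measure on a periodic orbit of $T$. An invariant measure is aperiodic if the set of periodic points has measure zero (for an ergodic measure: if it is not periodic). Edit distance: for words $u,w$ of length $n$ over a finite alphabet, $\bar f_n(u,w)=1-k/n$, where $k$ is the largest $\ell$ such that $u_{i_s}=w_{j_s}$ ($s=1,\dots,\ell$) for some $0\le i_1<\dots<i_\ell<n$ and $0\le j_1<\dots<j_\ell<n$. Loosely Kronecker: an ergodic $T$-invariant measure $\mu$ is loosely Kronecker if it has zero Kolmogorov–Sinai entropy and for every finite Borel partition $\mathcal P$ of $X$ and every $\varepsilon>0$ there are $n>0$ and a set $A_n$ of atoms of $\mathcal P^n=\bigvee_{j=0}^{n-1}T^{-j}(\mathcal P)$ whose union has $\mu$-measure greater than $1-\varepsilon$ and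 such that $\bar f_n(u,w)<\varepsilon$ for all $u,w\in A_n$; here an atom of $\mathcal P^n$ is identified with the word of length $n$ over $\{0,\dots,|\mathcal P|-1\}$ listing the indices of the elements of $\mathcal P$ successively visited. *)

theory Defs
  imports "HOL-Probability.Probability" "HOL-Library.Disjoint_Sets"
begin

section \<open>Invariant measures\<close>

definition trajectory :: "('a \<Rightarrow> 'a) \<Rightarrow> 'a \<Rightarrow> nat \<Rightarrow> 'a" where
  "trajectory T x = (\<lambda>j. (T ^^ j) x)"

definition borel_prob :: "'a::topological_space measure \<Rightarrow> bool" where
  "borel_prob \<mu> \<longleftrightarrow> prob_space \<mu> \<and> sets \<mu> = sets borel"

definition invariant_measure :: "('a::topological_space \<Rightarrow> 'a) \<Rightarrow> 'a measure \<Rightarrow> bool" where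
  "invariant_measure T \<mu> \<longleftrightarrow> borel_prob \<mu> \<and> distr \<mu> borel T = \<mu>"

definition ergodic_measure :: "('a::topological_space \<Rightarrow> 'a) \<Rightarrow> 'a measure \<Rightarrow> bool" where
  "ergodic_measure T \<mu> \<longleftrightarrow> invariant_measure T \<mu> \<and>
     (\<forall>A\<in>sets borel. T -` A = A \<longrightarrow> measure \<mu> A = 0 \<or> measure \<mu> A = 1)"

definition periodic_point :: "('a \<Rightarrow> 'a) \<Rightarrow> 'a \<Rightarrow> bool" where
  "periodic_point T x \<longleftrightarrow> (\<exists>p>0. (T ^^ p) x = x)"

definition periodic_measure :: "('a::topological_space \<Rightarrow> 'a) \<Rightarrow> 'a measure \<Rightarrow> bool" where
  "periodic_measure T \<mu> \<longleftrightarrow> (\<exists>x. periodic_point T x \<and>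
     \<mu> = distr (uniform_count_measure (range (trajectory T x))) borel (\<lambda>y. y))"

definition aperiodic_measure :: "('a \<Rightarrow> 'a) \<Rightarrow> 'a measure \<Rightarrow> bool" where
  "aperiodic_measure T \<mu> \<longleftrightarrow> {x. periodic_point T x} \<in> null_sets \<mu>"

section \<open>Generic sequences and quasi-orbits\<close>

text \<open>Pushing the uniform measure on the index set forward along the sequence keeps
  multiplicities, so for \<open>n > 0\<close> this is the average of the Dirac measures at
  \<open>x 0, \<dots>, x (n - 1)\<close>.\<close>

definition empirical_measure :: "(nat \<Rightarrow> 'a::topological_space) \<Rightarrow> nat \<Rightarrow> 'a measure" where
  "empirical_measure x n = distr (uniform_count_measure {..<n}) borel x"

text \<open>The test functions are all continuous real functions; they are bounded because the
  underlying space is compact wherever this notion is used.\<close>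

definition weak_star_tendsto ::
  "(nat \<Rightarrow> 'a::topological_space measure) \<Rightarrow> 'a measure \<Rightarrow> bool" where
  "weak_star_tendsto M \<mu> \<longleftrightarrow> (\<forall>f::'a \<Rightarrow> real. continuous_on UNIV f \<longrightarrow>
     (\<lambda>n. integral\<^sup>L (M n) f) \<longlonglongrightarrow> integral\<^sup>L \<mu> f)"

definition generic_seq :: "(nat \<Rightarrow> 'a::topological_space) \<Rightarrow> 'a measure \<Rightarrow> bool" where
  "generic_seq x \<mu> \<longleftrightarrow> borel_prob \<mu> \<and> weak_star_tendsto (empirical_measure x) \<mu>"

definition generic_point ::
  "('a::topological_space \<Rightarrow> 'a) \<Rightarrow> 'a \<Rightarrow> 'a measure \<Rightarrow> bool" where
  "generic_point T x \<mu> \<longleftrightarrow> generic_seq (trajectory T x) \<mu>"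

definition upper_density :: "nat set \<Rightarrow> ereal" where
  "upper_density A = limsup (\<lambda>n. ereal (real (card (A \<inter> {..<n})) / real n))"

definition quasi_orbit :: "('a \<Rightarrow> 'a) \<Rightarrow> (nat \<Rightarrow> 'a) \<Rightarrow> bool" where
  "quasi_orbit T z \<longleftrightarrow> upper_density {n. z (Suc n) \<noteq> T (z n)} = 0"

section \<open>The Feldman--Katok pseudometric\<close>

text \<open>Only the values of \<open>\<pi>\<close> on \<open>D\<close> matter; the size of the match is \<open>card D\<close>.\<close>

definition fk_match :: "nat \<Rightarrow> real \<Rightarrow> (nat \<Rightarrow> 'a::metric_space) \<Rightarrow> (nat \<Rightarrow> 'a) \<Rightarrow>
    nat set \<Rightarrow> nat set \<Rightarrow> (nat \<Rightarrow> nat) \<Rightarrow> bool" where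
  "fk_match n \<delta> x z D R \<pi> \<longleftrightarrow> D \<subseteq> {..<n} \<and> R \<subseteq> {..<n} \<and> bij_betw \<pi> D R \<and>
     strict_mono_on D \<pi> \<and> (\<forall>i\<in>D. dist (x i) (z (\<pi> i)) < \<delta>)"

definition fbar_n :: "nat \<Rightarrow> real \<Rightarrow> (nat \<Rightarrow> 'a::metric_space) \<Rightarrow> (nat \<Rightarrow> 'a) \<Rightarrow> real" where
  "fbar_n n \<delta> x z = 1 - real (Max {card D | D R \<pi>. fk_match n \<delta> x z D R \<pi>}) / real n"

definition fbar :: "real \<Rightarrow> (nat \<Rightarrow> 'a::metric_space) \<Rightarrow> (nat \<Rightarrow> 'a) \<Rightarrow> ereal" where
  "fbar \<delta> x z = limsup (\<lambda>n. ereal (fbar_n n \<delta> x z))"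

definition fk :: "(nat \<Rightarrow> 'a::metric_space) \<Rightarrow> (nat \<Rightarrow> 'a) \<Rightarrow> real" where
  "fk x z = Inf {\<delta>. \<delta> > 0 \<and> fbar \<delta> x z < ereal \<delta>}"

definition fk_point :: "('a::metric_space \<Rightarrow> 'a) \<Rightarrow> 'a \<Rightarrow> 'a \<Rightarrow> real" where
  "fk_point T x z = fk (trajectory T x) (trajectory T z)"

definition fk_Cauchy :: "('a::metric_space \<Rightarrow> 'a) \<Rightarrow> (nat \<Rightarrow> 'a) \<Rightarrow> bool" where
  "fk_Cauchy T X \<longleftrightarrow> (\<forall>\<epsilon>>0. \<exists>N. \<forall>m\<ge>N. \<forall>n\<ge>N. fk_point T (X m) (X n) < \<epsilon>)"

definition fk_limit ::
  "('a::metric_space \<Rightarrow> 'a) \<Rightarrow> (nat \<Rightarrow> 'a measure) \<Rightarrow> 'a measure \<Rightarrow> bool" where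
  "fk_limit T M \<mu> \<longleftrightarrow> invariant_measure T \<mu> \<and>
     (\<exists>X. (\<forall>n. generic_point T (X n) (M n)) \<and> fk_Cauchy T X \<and>
       (\<exists>z. quasi_orbit T z \<and> generic_seq z \<mu> \<and>
          (\<lambda>n. fk z (trajectory T (X n))) \<longlonglongrightarrow> 0))"

section \<open>Partitions and Kolmogorov--Sinai entropy\<close>

definition finite_borel_partition :: "'a::topological_space set set \<Rightarrow> bool" where
  "finite_borel_partition P \<longleftrightarrow> finite P \<and> P \<subseteq> sets borel \<and> partition_on UNIV P"

text \<open>An atom of the \<open>n\<close>-th join of \<open>P\<close> is coded by the word of length \<open>n\<close> that lists the
  cells of \<open>P\<close> visited successively; the cells themselves serve as letters. Only words of
  nonempty atoms are kept, so words and atoms correspond bijectively.\<close>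

definition atom_of :: "('a \<Rightarrow> 'a) \<Rightarrow> 'a set list \<Rightarrow> 'a set" where
  "atom_of T w = {x. \<forall>j<length w. (T ^^ j) x \<in> w ! j}"

definition join_words :: "('a \<Rightarrow> 'a) \<Rightarrow> 'a set set \<Rightarrow> nat \<Rightarrow> 'a set list set" where
  "join_words T P n = {w. length w = n \<and> set w \<subseteq> P \<and> atom_of T w \<noteq> {}}"

definition join_partition :: "('a \<Rightarrow> 'a) \<Rightarrow> 'a set set \<Rightarrow> nat \<Rightarrow> 'a set set" where
  "join_partition T P n = atom_of T ` join_words T P n"

definition partition_entropy :: "'a measure \<Rightarrow> 'a set set \<Rightarrow> real" where
  "partition_entropy \<mu> P = - (\<Sum>A\<in>P. measure \<mu> A * ln (measure \<mu> A))"

text \<open>For an invariant measure the upper limit is a limit, by subadditivity.\<close>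

definition dynamical_entropy ::
  "('a \<Rightarrow> 'a) \<Rightarrow> 'a measure \<Rightarrow> 'a set set \<Rightarrow> ereal" where
  "dynamical_entropy T \<mu> P =
     limsup (\<lambda>n. ereal (partition_entropy \<mu> (join_partition T P n) / real n))"

definition ks_entropy :: "('a::topological_space \<Rightarrow> 'a) \<Rightarrow> 'a measure \<Rightarrow> ereal" where
  "ks_entropy T \<mu> = (SUP P\<in>{P. finite_borel_partition P}. dynamical_entropy T \<mu> P)"

section \<open>Edit distance and loosely Kronecker measures\<close>

definition max_common_subword :: "'b list \<Rightarrow> 'b list \<Rightarrow> nat" where
  "max_common_subword u w = Max {l. \<exists>i j.
     strict_mono_on {..<l} i \<and> strict_mono_on {..<l} j \<and>
     (\<forall>s<l. i s < length u \<and> j s < length w \<and> u ! i s = w ! j s)}"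

text \<open>Used only for words \<open>u\<close>, \<open>w\<close> of the same length.\<close>

definition edit_distance :: "'b list \<Rightarrow> 'b list \<Rightarrow> real" where
  "edit_distance u w = 1 - real (max_common_subword u w) / real (length u)"

definition loosely_kronecker :: "('a::topological_space \<Rightarrow> 'a) \<Rightarrow> 'a measure \<Rightarrow> bool" where
  "loosely_kronecker T \<mu> \<longleftrightarrow> ergodic_measure T \<mu> \<and> ks_entropy T \<mu> = 0 \<and>
     (\<forall>P \<epsilon>. finite_borel_partition P \<longrightarrow> \<epsilon> > 0 \<longrightarrow>
       (\<exists>n>0. \<exists>A \<subseteq> join_words T P n.
          measure \<mu> (\<Union>w\<in>A. atom_of T w) > 1 - \<epsilon> \<and>
          (\<forall>u\<in>A. \<forall>w\<in>A. edit_distance u w < \<epsilon>)))"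

end

theory Submission
  imports Defs
begin

text \<open>Call a measure periodically approximable if most orbit segments of some length \<open>n\<close> are, up to
  a small error in the edit sense, close to a single word of points. Periodic measures have this
  property (take a long piece of the orbit), and so do loosely Kronecker measures (use a partition into
  cells of small diameter). Cutting a generic orbit of such a measure into blocks shows that it is close
  to a periodic sequence, hence so is the quasi-orbit \<open>z\<close> that is generic for the limit \<open>\<mu>\<close>.
  For large \<open>L\<close> most windows of length \<open>L\<close> of \<open>z\<close> are then close to one window of the periodic
  sequence, because its shifts by less than a period hardly differ. Genericity of \<open>z\<close> turns this into a
  statement about \<open>\<mu>\<close>-most orbit segments of length \<open>L\<close>, and inner regularity into one about
  \<open>P\<close>-names: for every partition and every large \<open>L\<close>, most \<open>L\<close>-names are close to each other.
  Ergodicity follows by applying this to an invariant set and its complement, and zero entropy by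
  counting the words in an edit ball.\<close>

section \<open>Order-preserving matchings\<close>

text \<open>Genericity controls visit frequencies in one direction only: visits to a closed set are
  bounded from above by its measure, visits to an open set from below. Hence the good set is open
  (\<open>< e\<close>) when frequencies are deduced from a measure and closed
  (\<open>\<le> e\<close>) when a measure is estimated from frequencies. The second obstacle is
  length. Being loosely Kronecker gives closeness of names for one \<open>n\<close> only, while the
  upper limit defining entropy asks for all large \<open>n\<close>. The period \<open>p\<close> of
  the approximating sequence is fixed by the accuracy, so a change of phase costs at most
  \<open>p\<close> of \<open>L\<close> positions, a vanishing proportion. The third obstacle is that
  closeness of points does not determine letters, since cells may have boundaries of positive
  measure. Closed cores of the cells, a positive distance apart by compactness, remedy this, and
  invariance limits the time spent outside the cores.\<close>

definition chain_rel :: "(nat \<times> nat) set \<Rightarrow> bool" where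
  "chain_rel S \<longleftrightarrow> (\<forall>(i, j)\<in>S. \<forall>(i', j')\<in>S. i < i' \<longleftrightarrow> j < j')"

text \<open>\<open>E\<close> is left arbitrary so that one calculus serves both closeness of points
  and equality of letters. \<open>k\<close> is a real lower bound, not the maximal size, so that
  losses are simply subtracted; a nonpositive \<open>k\<close> asks for nothing.\<close>

definition order_match :: "(nat \<Rightarrow> nat \<Rightarrow> bool) \<Rightarrow> nat \<Rightarrow> real \<Rightarrow> bool" where
  "order_match E n k \<longleftrightarrow> (\<exists>S. S \<subseteq> {..<n} \<times> {..<n} \<and> chain_rel S \<and>
     (\<forall>(i, j)\<in>S. E i j) \<and> k \<le> real (card S))"

lemma chain_relD: "chain_rel S \<Longrightarrow> (i, j) \<in> S \<Longrightarrow> (i', j') \<in> S \<Longrightarrow> i < i' \<longleftrightarrow> j < j'"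
  by (fastforce simp: chain_rel_def)

lemma chain_relI:
  "(\<And>i j i' j'. (i, j) \<in> S \<Longrightarrow> (i', j') \<in> S \<Longrightarrow> i < i' \<longleftrightarrow> j < j') \<Longrightarrow> chain_rel S"
  by (auto simp: chain_rel_def)

text \<open>Comparing two pairs in both orders decides equality, so a chain is the graph of an
  increasing partial injection without a separate injectivity condition.\<close>

lemma chain_rel_eq: "chain_rel S \<Longrightarrow> (i, j) \<in> S \<Longrightarrow> (i', j') \<in> S \<Longrightarrow> i = i' \<longleftrightarrow> j = j'"
  by (metis chain_relD nat_neq_iff)

lemma chain_rel_subset: "chain_rel S \<Longrightarrow> S' \<subseteq> S \<Longrightarrow> chain_rel S'"
  by (rule chain_relI) (blast dest: chain_relD)

lemma inj_on_fst_chain: "chain_rel S \<Longrightarrow> inj_on fst S"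
  by (auto simp: inj_on_def chain_rel_eq)

lemma inj_on_snd_chain: "chain_rel S \<Longrightarrow> inj_on snd S"
  by (auto simp: inj_on_def chain_rel_eq)

lemma order_matchI:
  "S \<subseteq> {..<n} \<times> {..<n} \<Longrightarrow> chain_rel S \<Longrightarrow> (\<And>i j. (i, j) \<in> S \<Longrightarrow> E i j) \<Longrightarrow> k \<le> real (card S)
    \<Longrightarrow> order_match E n k"
  by (auto simp: order_match_def)

lemma order_matchE:
  assumes "order_match E n k"
  obtains S where "S \<subseteq> {..<n} \<times> {..<n}" "finite S" "chain_rel S" "\<forall>i j. (i, j) \<in> S \<longrightarrow> E i j"
    "k \<le> real (card S)"
proof -
  obtain S where S: "S \<subseteq> {..<n} \<times> {..<n}" "chain_rel S" "\<forall>(i, j)\<in>S. E i j" "k \<le> real (card S)"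
    using assms by (auto simp: order_match_def)
  then have "finite S" by (meson finite_SigmaI finite_lessThan finite_subset)
  with S that show ?thesis by blast
qed

lemma order_match_mono:
  assumes "order_match E n k" "\<And>i j. i < n \<Longrightarrow> j < n \<Longrightarrow> E i j \<Longrightarrow> E' i j" "k' \<le> k"
  shows "order_match E' n k'"
proof -
  obtain S where S: "S \<subseteq> {..<n} \<times> {..<n}" "finite S" "chain_rel S" "\<forall>i j. (i, j) \<in> S \<longrightarrow> E i j" "k \<le> real (card S)"
    using assms(1) by (rule order_matchE)
  show ?thesis
    by (rule order_matchI[of S]) (use S assms(2,3) in \<open>auto intro: order_trans\<close>)
qed

lemma order_match_converse:
  assumes "order_match E n k"
  shows "order_match (\<lambda>i j. E j i) n k"
proof -
  obtain S where S: "S \<subseteq> {..<n} \<times> {..<n}" "finite S" "chain_rel S" "\<forall>i j. (i, j) \<in> S \<longrightarrow> E i j" "k \<le> real (card S)"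
    using assms(1) by (rule order_matchE)
  show ?thesis
    by (rule order_matchI[of "S\<inverse>"]) (use S in \<open>auto simp: chain_rel_def\<close>)
qed

text \<open>The middle indices used by the two matches form subsets of \<open>{..<n}\<close> of
  sizes at least \<open>k\<close> and \<open>k'\<close>, so at least \<open>k + k' - n\<close> are
  common, and each common one links a pair of the relational composite.\<close>

lemma order_match_compose:
  assumes "order_match E n k" "order_match E' n k'"
    and E'': "\<And>i j l. i < n \<Longrightarrow> j < n \<Longrightarrow> l < n \<Longrightarrow> E i j \<Longrightarrow> E' j l \<Longrightarrow> E'' i l"
  shows "order_match E'' n (k + k' - real n)"
proof -
  obtain S where S: "S \<subseteq> {..<n} \<times> {..<n}" "finite S" "chain_rel S" "\<forall>i j. (i, j) \<in> S \<longrightarrow> E i j" "k \<le> real (card S)"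
    using assms(1) by (rule order_matchE)
  obtain S' where S': "S' \<subseteq> {..<n} \<times> {..<n}" "finite S'" "chain_rel S'" "\<forall>i j. (i, j) \<in> S' \<longrightarrow> E' i j" "k' \<le> real (card S')"
    using assms(2) by (rule order_matchE)
  let ?J = "snd ` S \<inter> fst ` S'"
  have "card (snd ` S \<union> fst ` S') \<le> card {..<n}"
    by (rule card_mono) (use S(1) S'(1) in auto)
  moreover have "card (snd ` S) + card (fst ` S') = card (snd ` S \<union> fst ` S') + card ?J"
    by (rule card_Un_Int) (use S S' in auto)
  ultimately have 1: "card S + card S' \<le> n + card ?J"
    using card_image[OF inj_on_snd_chain[OF S(3)]] card_image[OF inj_on_fst_chain[OF S'(3)]] by simp
  have fin: "finite (S O S')" using S(2) S'(2) by (rule finite_relcomp)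
  \<comment> \<open>\<open>h\<close> returns the pair linked through \<open>j\<close>; both
    descriptions are unique because chains are injective.\<close>
  define h where "h = (\<lambda>j. (THE i. (i, j) \<in> S, THE l. (j, l) \<in> S'))"
  have h: "h j = (i, l)" if "(i, j) \<in> S" "(j, l) \<in> S'" for i j l
  proof -
    have "(THE i. (i, j) \<in> S) = i" by (rule the_equality) (use that chain_rel_eq[OF S(3)] in blast)+
    moreover have "(THE l. (j, l) \<in> S') = l" by (rule the_equality) (use that chain_rel_eq[OF S'(3)] in blast)+
    ultimately show ?thesis by (simp add: h_def)
  qed
  have "inj_on h ?J"
  proof (rule inj_onI)
    fix j j' assume "j \<in> ?J" "j' \<in> ?J" and eq: "h j = h j'"
    then obtain i l i' l' where "(i, j) \<in> S" "(j, l) \<in> S'" "(i', j') \<in> S" "(j', l') \<in> S'" by auto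
    then show "j = j'" using h eq chain_rel_eq[OF S(3)] by (metis prod.inject)
  qed
  moreover have "h ` ?J \<subseteq> S O S'" using h by fastforce
  ultimately have 2: "card ?J \<le> card (S O S')" using fin by (metis card_image card_mono)
  show ?thesis
  proof (rule order_matchI)
    show "S O S' \<subseteq> {..<n} \<times> {..<n}" using S(1) S'(1) by auto
    show "chain_rel (S O S')"
    proof (rule chain_relI)
      fix i l i' l' assume "(i, l) \<in> S O S'" "(i', l') \<in> S O S'"
      then obtain j j' where "(i, j) \<in> S" "(j, l) \<in> S'" "(i', j') \<in> S" "(j', l') \<in> S'" by blast
      then show "i < i' \<longleftrightarrow> l < l'" using chain_relD[OF S(3)] chain_relD[OF S'(3)] by blast
    qed
    show "E'' i l" if "(i, l) \<in> S O S'" for i l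
      using that S(1) S'(1) S(4) S'(4) E'' by blast
    show "k + k' - real n \<le> real (card (S O S'))"
      using 1 2 S(5) S'(5) by linarith
  qed
qed

text \<open>A chain is injective, so each index violating \<open>P\<close> destroys at most one
  pair.\<close>

lemma order_match_restrict_left:
  assumes "order_match E n k" and card: "real (card {i. i < n \<and> \<not> P i}) \<le> a"
  shows "order_match (\<lambda>i j. E i j \<and> P i) n (k - a)"
proof -
  obtain S where S: "S \<subseteq> {..<n} \<times> {..<n}" "finite S" "chain_rel S" "\<forall>i j. (i, j) \<in> S \<longrightarrow> E i j" "k \<le> real (card S)"
    using assms(1) by (rule order_matchE)
  let ?S = "{s\<in>S. P (fst s)}"
  have "card (S - ?S) = card (fst ` (S - ?S))"
    by (rule card_image[symmetric], rule inj_on_subset[OF inj_on_fst_chain[OF S(3)]]) auto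
  also have "\<dots> \<le> card {i. i < n \<and> \<not> P i}" by (rule card_mono) (use S in auto)
  finally have "card S \<le> card ?S + card {i. i < n \<and> \<not> P i}"
    using S(2) by (simp add: card_Diff_subset)
  then have 1: "k - a \<le> real (card ?S)" using card S(5) by linarith
  show ?thesis
    by (rule order_matchI[of ?S]) (use S 1 in \<open>auto intro: chain_rel_subset\<close>)
qed

lemma order_match_restrict_right:
  assumes "order_match E n k" "real (card {j. j < n \<and> \<not> P j}) \<le> a"
  shows "order_match (\<lambda>i j. E i j \<and> P j) n (k - a)"
  using order_match_converse[OF order_match_restrict_left[OF order_match_converse[OF assms(1)] assms(2)]] by simp

lemma order_match_empty: "k \<le> 0 \<Longrightarrow> order_match E n k"
  by (rule order_matchI[of "{}"]) (auto simp: chain_rel_def)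

lemma chain_rel_translate:
  assumes "chain_rel S"
  shows "chain_rel ((\<lambda>(a, b). (a + c, b + d)) ` S)"
  by (rule chain_relI) (use chain_relD[OF assms] in auto)

lemma order_match_refl:
  assumes "\<And>i. i < n \<Longrightarrow> E i i"
  shows "order_match E n (real n)"
proof (rule order_matchI[of "(\<lambda>i. (i, i)) ` {..<n}"])
  have "inj_on (\<lambda>i. (i, i)) {..<n}" by (auto simp: inj_on_def)
  then show "real n \<le> real (card ((\<lambda>i. (i, i)) ` {..<n}))" by (simp add: card_image)
qed (use assms in \<open>auto simp: chain_rel_def\<close>)

text \<open>The offsets \<open>c\<close> and \<open>d\<close> are independent, which allows a
  position to be skipped on one side only.\<close>

lemma order_match_shift:
  assumes "order_match (\<lambda>a b. E (a + c) (b + d)) n k" "n + c \<le> m" "n + d \<le> m"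
  shows "order_match E m k"
proof -
  obtain S where S: "S \<subseteq> {..<n} \<times> {..<n}" "finite S" "chain_rel S"
    "\<forall>a b. (a, b) \<in> S \<longrightarrow> E (a + c) (b + d)" "k \<le> real (card S)"
    using assms(1) by (rule order_matchE)
  let ?f = "\<lambda>(a, b). (a + c, b + d)"
  have "inj_on ?f S" by (auto simp: inj_on_def)
  then have "card (?f ` S) = card S" by (rule card_image)
  then show ?thesis
    by (intro order_matchI[of "?f ` S"]) (use S assms(2,3) chain_rel_translate[OF S(3)] in auto)
qed

lemma order_match_append:
  assumes "order_match E m k" "order_match (\<lambda>a b. E (a + m) (b + m)) n k'"
  shows "order_match E (m + n) (k + k')"
proof -
  obtain S where S: "S \<subseteq> {..<m} \<times> {..<m}" "finite S" "chain_rel S"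
    "\<forall>a b. (a, b) \<in> S \<longrightarrow> E a b" "k \<le> real (card S)"
    using assms(1) by (rule order_matchE)
  obtain S' where S': "S' \<subseteq> {..<n} \<times> {..<n}" "finite S'" "chain_rel S'"
    "\<forall>a b. (a, b) \<in> S' \<longrightarrow> E (a + m) (b + m)" "k' \<le> real (card S')"
    using assms(2) by (rule order_matchE)
  define f where "f = (\<lambda>(a, b). (a + m, b + m :: nat))"
  have "inj_on f S'" by (auto simp: inj_on_def f_def)
  then have c: "card (f ` S') = card S'" by (rule card_image)
  have "S \<inter> f ` S' = {}" using S(1) by (auto simp: f_def)
  then have card: "card (S \<union> f ` S') = card S + card S'" using S(2) S'(2) c by (simp add: card_Un_disjoint)
  show ?thesis
  proof (rule order_matchI)
    show "S \<union> f ` S' \<subseteq> {..<m + n} \<times> {..<m + n}" using S(1) S'(1) by (auto simp: f_def)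
    show "chain_rel (S \<union> f ` S')"
    proof (rule chain_relI)
      fix i j i' j' assume "(i, j) \<in> S \<union> f ` S'" "(i', j') \<in> S \<union> f ` S'"
      then consider "(i, j) \<in> S" "(i', j') \<in> S" | "(i, j) \<in> S" "(i', j') \<in> f ` S'"
        | "(i, j) \<in> f ` S'" "(i', j') \<in> S" | "(i, j) \<in> f ` S'" "(i', j') \<in> f ` S'" by blast
      then show "i < i' \<longleftrightarrow> j < j'"
      proof cases
        case 1 then show ?thesis by (rule chain_relD[OF S(3)])
      next
        case 2 then show ?thesis using subsetD[OF S(1)] by (fastforce simp: f_def)
      next
        case 3 then show ?thesis using subsetD[OF S(1)] by (fastforce simp: f_def)
      next
        case 4 then show ?thesis using chain_relD[OF S'(3)] by (auto simp: f_def)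
      qed
    qed
    show "E i j" if "(i, j) \<in> S \<union> f ` S'" for i j using that S(4) S'(4) by (auto simp: f_def)
    show "k + k' \<le> real (card (S \<union> f ` S'))" using S(5) S'(5) card by simp
  qed
qed

text \<open>Greedy matching with a periodic sequence: at a good position match a whole block,
  otherwise skip one position.\<close>

lemma order_match_blocks:
  assumes "n > 0" "0 \<le> e"
    and per: "\<And>i j. E i (j + n) \<longleftrightarrow> E i j"
    and block: "\<And>i. good i \<Longrightarrow> order_match (\<lambda>a b. E (a + i) b) n ((1 - e) * real n)"
  shows "order_match (\<lambda>a b. E (a + i) b) N
    (real N - real (card {j\<in>{i..<i + N}. \<not> good j}) - e * real N - real n)"
proof (induction N arbitrary: i rule: less_induct)
  case (less N)
  show ?case
  proof (cases "N < n")
    case True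
    \<comment> \<open>Less than one block remains: the term \<open>- real n\<close> already makes
      the bound nonpositive.\<close>
    have "0 \<le> e * real N" using \<open>0 \<le> e\<close> by simp
    then show ?thesis using True by (intro order_match_empty) linarith
  next
    case False
    show ?thesis
    proof (cases "good i")
      case True
      have "card {j\<in>{i + n..<i + n + (N - n)}. \<not> good j} \<le> card {j\<in>{i..<i + N}. \<not> good j}"
        by (rule card_mono) (use False in auto)
      \<comment> \<open>By periodicity the second sequence may be read from 0 again after the block,
        so the induction hypothesis applies to the remaining \<open>N - n\<close> positions.\<close>
      moreover have "order_match (\<lambda>a b. E (a + i) b) (n + (N - n)) ((1 - e) * real n +
          (real (N - n) - real (card {j\<in>{i + n..<i + n + (N - n)}. \<not> good j}) - e * real (N - n) - real n))"
        by (rule order_match_append[OF block[OF True]])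
          (use less.IH[of "N - n" "i + n"] False \<open>n > 0\<close> in \<open>simp add: per ac_simps\<close>)
      moreover have "real (N - n) = real N - real n" "n + (N - n) = N" using False by auto
      ultimately show ?thesis
        by (simp only:) (elim order_match_mono; simp add: algebra_simps)
    next
      case bad: False
      then have eq: "{j\<in>{i..<i + N}. \<not> good j} = insert i {j\<in>{i + 1..<i + 1 + (N - 1)}. \<not> good j}"
        using \<open>\<not> N < n\<close> \<open>n > 0\<close> by (auto simp: Suc_le_eq le_less)
      have card: "card {j\<in>{i..<i + N}. \<not> good j} = Suc (card {j\<in>{i + 1..<i + 1 + (N - 1)}. \<not> good j})"
        unfolding eq by (rule card_insert_disjoint) auto
      \<comment> \<open>Only the first sequence advances. The lost position is paid for by
        \<open>i\<close> dropping out of the count of bad positions.\<close>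
      have "order_match (\<lambda>a b. E (a + i) b) N
          (real (N - 1) - real (card {j\<in>{i + 1..<i + 1 + (N - 1)}. \<not> good j}) - e * real (N - 1) - real n)"
        by (rule order_match_shift[where c = 1 and d = 0 and n = "N - 1"])
          (use less.IH[of "N - 1" "i + 1"] \<open>\<not> N < n\<close> \<open>n > 0\<close> in \<open>simp_all add: ac_simps\<close>)
      moreover have "real (N - 1) = real N - 1" using \<open>\<not> N < n\<close> \<open>n > 0\<close> by simp
      ultimately show ?thesis
        by (elim order_match_mono) (use card \<open>0 \<le> e\<close> in \<open>auto simp: algebra_simps\<close>)
    qed
  qed
qed

text \<open>Periodicity reduces the offset \<open>b\<close> to \<open>b mod p\<close>, which is
  below \<open>p\<close>. Absorbing this offset into the right indices pushes at most
  \<open>b mod p\<close> of them out of \<open>{..<L}\<close>.\<close>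

lemma order_match_periodic_origin:
  assumes m: "order_match (\<lambda>a c. E a (b + c)) L k" and "p > 0"
    and per: "\<And>i j. E i (j + p) \<longleftrightarrow> E i j"
  shows "order_match E L (k - real p)"
proof -
  let ?b = "b mod p"
  have per': "E i (j + q * p) \<longleftrightarrow> E i j" for i j q
    by (induction q) (auto simp: per add.assoc[symmetric] add.commute[of p])
  have "b + c = (?b + c) + (b div p) * p" for c by (simp add: div_mult_mod_eq)
  then have E: "E a (b + c) \<longleftrightarrow> E a (?b + c)" for a c by (metis per')
  have "{c. c < L \<and> \<not> ?b + c < L} \<subseteq> {L - ?b..<L}" by auto
  then have "card {c. c < L \<and> \<not> ?b + c < L} \<le> card {L - ?b..<L}" by (intro card_mono) auto
  also have "\<dots> \<le> ?b" by simp
  also have "\<dots> \<le> p" using \<open>p > 0\<close> by (simp add: less_imp_le)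
  finally have "order_match (\<lambda>a c. E a (b + c) \<and> ?b + c < L) L (k - real p)"
    by (intro order_match_restrict_right[OF m]) simp
  then obtain S where S: "S \<subseteq> {..<L} \<times> {..<L}" "finite S" "chain_rel S"
    "\<forall>a c. (a, c) \<in> S \<longrightarrow> E a (b + c) \<and> ?b + c < L" "k - real p \<le> real (card S)"
    by (rule order_matchE)
  let ?f = "\<lambda>(a, c). (a + 0, c + ?b)"
  have "inj_on ?f S" by (auto simp: inj_on_def)
  then have "card (?f ` S) = card S" by (rule card_image)
  then show ?thesis
    by (intro order_matchI[of "?f ` S"]) (use S E chain_rel_translate[OF S(3), of 0 ?b] in \<open>auto simp: add.commute\<close>)
qed

text \<open>Most windows of length \<open>L\<close> of a well-matched sequence match a window of the other one:
  an index unmatched on either side spoils at most \<open>L\<close> windows, namely those containing it or,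
  on the right, those whose image encloses it.\<close>

lemma order_match_windows:
  assumes m: "order_match E N ((1 - \<eta>) * real N)" and "L > 0"
  shows "\<theta> * real (card {i. i + L \<le> N \<and> \<not> (\<exists>b. order_match (\<lambda>a c. E (i + a) (b + c)) L ((1 - \<theta>) * real L))})
    \<le> 2 * \<eta> * real N"
proof -
  obtain S where S: "S \<subseteq> {..<N} \<times> {..<N}" "finite S" "chain_rel S"
    "\<forall>a b. (a, b) \<in> S \<longrightarrow> E a b" "(1 - \<eta>) * real N \<le> real (card S)"
    using m by (rule order_matchE)
  define U where "U = {..<N} - fst ` S"
  define V where "V = {..<N} - snd ` S"
  \<comment> \<open>Two kinds of loss occur for the window at \<open>i\<close>: \<open>UU\<close>
    collects the holes in the window itself, \<open>VV\<close> the holes between the images, which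
    can push images beyond a right window of length \<open>L\<close>.\<close>
  define W where "W = (\<lambda>i. {s\<in>S. i \<le> fst s \<and> fst s < i + L})"
  define UU where "UU = (\<lambda>i. {u\<in>U. i \<le> u \<and> u < i + L})"
  define VV where "VV = (\<lambda>i. {q\<in>V. \<exists>s\<in>W i. \<exists>t\<in>W i. snd s < q \<and> q < snd t})"
  define I where "I = {i. i + L \<le> N}"
  have finI: "finite I" unfolding I_def by (rule finite_subset[of _ "{..N}"]) auto
  have fin: "finite U" "finite V" by (auto simp: U_def V_def)
  have "card (fst ` S) \<le> card {..<N}" by (rule card_mono) (use S(1) in auto)
  then have SN: "card S \<le> N" using card_image[OF inj_on_fst_chain[OF S(3)]] by simp
  have "card U = N - card S" unfolding U_def
    using S(1,2) card_image[OF inj_on_fst_chain[OF S(3)]] by (subst card_Diff_subset) auto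
  then have cU: "real (card U) \<le> \<eta> * real N" using S(5) SN by (simp add: algebra_simps of_nat_diff)
  have "card V = N - card S" unfolding V_def
    using S(1,2) card_image[OF inj_on_snd_chain[OF S(3)]] by (subst card_Diff_subset) auto
  then have cV: "real (card V) \<le> \<eta> * real N" using S(5) SN by (simp add: algebra_simps of_nat_diff)
  have window: "\<exists>b. order_match (\<lambda>a c. E (i + a) (b + c)) L (real L - real (card (UU i)) - real (card (VV i)))"
    if i: "i \<in> I" for i
  proof (cases "W i = {}")
    case True
    \<comment> \<open>Nothing in the window is matched, so the bound is nonpositive and any
      \<open>b\<close> serves.\<close>
    then have "{i..<i + L} \<subseteq> UU i" using i by (fastforce simp: W_def UU_def U_def I_def)
    then have "card {i..<i + L} \<le> card (UU i)" using fin by (intro card_mono) (auto simp: UU_def)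
    then show ?thesis by (intro exI[of _ 0] order_match_empty) simp
  next
    case False
    \<comment> \<open>The right window starts at the least image, so only its right end can cut off
      pairs.\<close>
    define b where "b = Min (snd ` W i)"
    define Wb where "Wb = {s\<in>W i. snd s < b + L}"
    have finW: "finite (W i)" using S(2) by (auto simp: W_def)
    have "b \<in> snd ` W i" unfolding b_def using finW False by (intro Min_in) auto
    then obtain s0 where s0: "s0 \<in> W i" "snd s0 = b" by auto
    have ble: "b \<le> snd s" if "s \<in> W i" for s unfolding b_def using finW that by (intro Min_le) auto
    have "real L - real (card (UU i)) - real (card (VV i)) \<le> real (card Wb)"
    \<comment> \<open>If all images fit, only \<open>UU i\<close> costs. If some image overshoots,
      the right window fills up instead: a matched index in it lies between two images, so its
      partner is in the left window, and the unmatched ones belong to \<open>VV i\<close>.\<close>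
    proof (cases "\<forall>t\<in>W i. snd t < b + L")
      case True
      then have "Wb = W i" by (auto simp: Wb_def)
      have "{i..<i + L} \<subseteq> fst ` W i \<union> UU i" using i by (fastforce simp: W_def UU_def U_def I_def)
      then have "card {i..<i + L} \<le> card (fst ` W i \<union> UU i)"
        using fin finW by (intro card_mono) (auto simp: UU_def)
      also have "\<dots> \<le> card (fst ` W i) + card (UU i)" by (rule card_Un_le)
      also have "\<dots> \<le> card Wb + card (UU i)" using card_image_le[OF finW] \<open>Wb = W i\<close> by simp
      finally show ?thesis by simp
    next
      case False
      then obtain t where t: "t \<in> W i" "b + L \<le> snd t" by (auto simp: not_less)
      have tN: "snd t < N" using t(1) S(1) by (auto simp: W_def)
      have "{b..<b + L} \<subseteq> snd ` Wb \<union> VV i"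
      proof
        fix q assume q: "q \<in> {b..<b + L}"
        show "q \<in> snd ` Wb \<union> VV i"
        proof (cases "q \<in> snd ` S")
          case True
          then obtain s where s: "s \<in> S" "snd s = q" by auto
          have "fst s0 \<le> fst s"
            using chain_relD[OF S(3), of "fst s" "snd s" "fst s0" "snd s0"] s s0 q by (auto simp: W_def not_less[symmetric])
          moreover have "fst s < fst t"
            using chain_relD[OF S(3), of "fst s" "snd s" "fst t" "snd t"] s t q by (auto simp: W_def)
          ultimately have "s \<in> W i" using s s0 t by (auto simp: W_def)
          then show ?thesis using s q by (auto simp: Wb_def)
        next
          case False
          then have "q \<noteq> b" using s0 by (auto simp: W_def)
          then have "q \<in> V" "snd s0 < q" "q < snd t" using False q t s0 tN by (auto simp: V_def)
          then have "q \<in> VV i" unfolding VV_def using s0(1) t(1) by blast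
          then show ?thesis by simp
        qed
      qed
      moreover have finWb: "finite Wb" using finW by (auto simp: Wb_def)
      ultimately have "card {b..<b + L} \<le> card (snd ` Wb \<union> VV i)"
        using fin by (intro card_mono) (auto simp: VV_def)
      also have "\<dots> \<le> card (snd ` Wb) + card (VV i)" by (rule card_Un_le)
      also have "\<dots> \<le> card Wb + card (VV i)" using card_image_le[OF finWb] by simp
      finally show ?thesis by simp
    qed
    moreover
    let ?f = "\<lambda>(p, q). (p - i, q - b)"
    have inj: "inj_on ?f Wb"
    proof (rule inj_onI)
      fix s t assume "s \<in> Wb" "t \<in> Wb" "?f s = ?f t"
      then show "s = t" using ble[of s] ble[of t] by (cases s; cases t) (auto simp: Wb_def W_def)
    qed
    have chain: "chain_rel (?f ` Wb)"
    proof (rule chain_relI)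
      fix p q p' q' assume "(p, q) \<in> ?f ` Wb" "(p', q') \<in> ?f ` Wb"
      then obtain s t where st: "s \<in> Wb" "t \<in> Wb" "p = fst s - i" "q = snd s - b" "p' = fst t - i" "q' = snd t - b"
        by (auto simp: case_prod_beta)
      then have "i \<le> fst s" "i \<le> fst t" "b \<le> snd s" "b \<le> snd t" using ble by (auto simp: Wb_def W_def)
      moreover have "fst s < fst t \<longleftrightarrow> snd s < snd t"
        using chain_relD[OF S(3), of "fst s" "snd s" "fst t" "snd t"] st by (auto simp: Wb_def W_def)
      ultimately show "p < p' \<longleftrightarrow> q < q'" using st by auto
    qed
    ultimately have "order_match (\<lambda>a c. E (i + a) (b + c)) L (real L - real (card (UU i)) - real (card (VV i)))"
    proof (intro order_matchI[of "?f ` Wb"])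
      show "?f ` Wb \<subseteq> {..<L} \<times> {..<L}" using ble \<open>L > 0\<close> by (fastforce simp: Wb_def W_def)
      show "E (i + a) (b + c)" if ac: "(a, c) \<in> ?f ` Wb" for a c
      proof -
        obtain s where s: "s \<in> Wb" "a = fst s - i" "c = snd s - b" using ac by (auto simp: case_prod_beta)
        then have "i \<le> fst s" "b \<le> snd s" "(fst s, snd s) \<in> S" using ble by (auto simp: Wb_def W_def)
        then show ?thesis using S(4) s by auto
      qed
    qed (use inj chain in \<open>auto simp: card_image\<close>)
    then show ?thesis by blast
  qed
  have short: "card {i\<in>I. i \<le> a \<and> a < i + L} \<le> L" for a
  proof -
    have "{i\<in>I. i \<le> a \<and> a < i + L} \<subseteq> {Suc a - L..<Suc a}" by auto
    then have "card {i\<in>I. i \<le> a \<and> a < i + L} \<le> card {Suc a - L..<Suc a}" by (intro card_mono) auto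
    also have "\<dots> \<le> L" by simp
    finally show ?thesis .
  qed
  have sumU: "(\<Sum>i\<in>I. card (UU i)) \<le> card U * L"
  proof -
    have "(\<Sum>i\<in>I. card (UU i)) = (\<Sum>u\<in>U. card {i\<in>I. i \<le> u \<and> u < i + L})"
      unfolding UU_def by (rule sum_multicount_gen) (use finI fin in auto)
    also have "\<dots> \<le> (\<Sum>u\<in>U. L)" by (rule sum_mono) (rule short)
    finally show ?thesis by simp
  qed
  have sumV: "(\<Sum>i\<in>I. card (VV i)) \<le> card V * L"
  proof -
    have "(\<Sum>i\<in>I. card (VV i)) = (\<Sum>q\<in>V. card {i\<in>I. \<exists>s\<in>W i. \<exists>t\<in>W i. snd s < q \<and> q < snd t})"
      unfolding VV_def by (rule sum_multicount_gen) (use finI fin in auto)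
    also have "\<dots> \<le> (\<Sum>q\<in>V. L)"
    proof (rule sum_mono)
      fix q assume "q \<in> V"
      \<comment> \<open>The last left index matched below \<open>q\<close>. A pair with image below
        \<open>q\<close> starts at or before \<open>a\<close>, one with image above \<open>q\<close>
        starts after \<open>a\<close>, so every window counted for \<open>q\<close> contains
        \<open>a\<close>.\<close>
      define a where "a = Max (fst ` {s\<in>S. snd s < q})"
      have "{i\<in>I. \<exists>s\<in>W i. \<exists>t\<in>W i. snd s < q \<and> q < snd t} \<subseteq> {i\<in>I. i \<le> a \<and> a < i + L}"
      proof safe
        fix i s t assume st: "s \<in> W i" "t \<in> W i" "snd s < q" "q < snd t"
        have finS: "finite (fst ` {s\<in>S. snd s < q})" using S(2) by auto
        have sin: "fst s \<in> fst ` {s\<in>S. snd s < q}" using st by (auto simp: W_def)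
        then have "fst s \<le> a" unfolding a_def by (rule Max_ge[OF finS])
        then show "i \<le> a" using st by (auto simp: W_def)
        have "a \<in> fst ` {s\<in>S. snd s < q}" unfolding a_def by (rule Max_in[OF finS]) (use sin in blast)
        then obtain r where r: "r \<in> S" "snd r < q" "fst r = a" by auto
        then have "a < fst t"
          using chain_relD[OF S(3), of "fst r" "snd r" "fst t" "snd t"] st by (auto simp: W_def)
        then show "a < i + L" using st by (auto simp: W_def)
      qed
      then have "card {i\<in>I. \<exists>s\<in>W i. \<exists>t\<in>W i. snd s < q \<and> q < snd t} \<le> card {i\<in>I. i \<le> a \<and> a < i + L}"
        using finI by (intro card_mono) auto
      then show "card {i\<in>I. \<exists>s\<in>W i. \<exists>t\<in>W i. snd s < q \<and> q < snd t} \<le> L" using short[of a] by linarith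
    qed
    finally show ?thesis by simp
  qed
  define B where "B = {i. i + L \<le> N \<and> \<not> (\<exists>b. order_match (\<lambda>a c. E (i + a) (b + c)) L ((1 - \<theta>) * real L))}"
  have BI: "B \<subseteq> I" by (auto simp: B_def I_def)
  \<comment> \<open>Double counting: a bad window has at least \<open>\<theta> * L\<close> holes,
    and a hole is charged to at most \<open>L\<close> windows. The factor 2 stands for the holes on
    both sides.\<close>
  have "\<theta> * real L * real (card B) = (\<Sum>i\<in>B. \<theta> * real L)" by simp
  also have "\<dots> \<le> (\<Sum>i\<in>B. real (card (UU i)) + real (card (VV i)))"
  proof (rule sum_mono, rule ccontr)
    fix i assume i: "i \<in> B" and "\<not> \<theta> * real L \<le> real (card (UU i)) + real (card (VV i))"
    then have le: "(1 - \<theta>) * real L \<le> real L - real (card (UU i)) - real (card (VV i))" by (simp add: algebra_simps)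
    obtain b where "order_match (\<lambda>a c. E (i + a) (b + c)) L (real L - real (card (UU i)) - real (card (VV i)))"
      using window i BI by blast
    then have "order_match (\<lambda>a c. E (i + a) (b + c)) L ((1 - \<theta>) * real L)"
      by (rule order_match_mono) (use le in auto)
    then show False using i by (auto simp: B_def)
  qed
  also have "\<dots> \<le> (\<Sum>i\<in>I. real (card (UU i)) + real (card (VV i)))"
    by (rule sum_mono2[OF finI BI]) auto
  also have "\<dots> = real (\<Sum>i\<in>I. card (UU i)) + real (\<Sum>i\<in>I. card (VV i))" by (simp add: sum.distrib)
  also have "\<dots> \<le> real (card U * L) + real (card V * L)" using sumU sumV by linarith
  also have "\<dots> = (real (card U) + real (card V)) * real L" by (simp add: algebra_simps)
  also have "\<dots> \<le> (2 * \<eta> * real N) * real L" using cU cV by (intro mult_right_mono) auto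
  finally show ?thesis using \<open>L > 0\<close> unfolding B_def[symmetric] by (simp add: algebra_simps)
qed

section \<open>Translation between matchings, \<open>fbar_n\<close> and
  \<open>edit_distance\<close>\<close>

lemma order_match_fbar_n:
  assumes "fbar_n n \<delta> x z < e" "n > 0"
  shows "order_match (\<lambda>i j. dist (x i) (z j) < \<delta>) n ((1 - e) * real n)"
proof -
  let ?C = "{card D | D R \<pi>. fk_match n \<delta> x z D R \<pi>}"
  have "?C \<subseteq> {..n}"
    by (auto simp: fk_match_def) (metis card_lessThan card_mono finite_lessThan)
  then have fin: "finite ?C" by (meson finite_atMost finite_subset)
  have "fk_match n \<delta> x z {} {} id" by (auto simp: fk_match_def strict_mono_on_def)
  then have "?C \<noteq> {}" by blast
  from Max_in[OF fin this] obtain D R \<pi> where m: "fk_match n \<delta> x z D R \<pi>" and D: "Max ?C = card D" by auto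
  have lt: "(1 - e) * real n < real (card D)"
    using assms unfolding fbar_n_def D by (simp add: field_simps)
  have inj: "inj_on (\<lambda>i. (i, \<pi> i)) D" by (auto simp: inj_on_def)
  have mono: "i < i' \<longleftrightarrow> \<pi> i < \<pi> i'" if "i \<in> D" "i' \<in> D" for i i'
    using m that by (metis fk_match_def strict_mono_on_less)
  show ?thesis
  proof (rule order_matchI[of "(\<lambda>i. (i, \<pi> i)) ` D"])
    show "(\<lambda>i. (i, \<pi> i)) ` D \<subseteq> {..<n} \<times> {..<n}" using m by (auto simp: fk_match_def bij_betw_def)
    show "(1 - e) * real n \<le> real (card ((\<lambda>i. (i, \<pi> i)) ` D))" using lt inj by (simp add: card_image)
  qed (use m mono in \<open>auto simp: fk_match_def chain_rel_def\<close>)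
qed

lemma max_common_subword_set:
  fixes u w :: "'b list"
  defines "C \<equiv> {l. \<exists>i j. strict_mono_on {..<l} i \<and> strict_mono_on {..<l} j \<and>
     (\<forall>s<l. i s < length u \<and> j s < length w \<and> u ! i s = w ! j s)}"
  shows "finite (C :: nat set)" "C \<noteq> {}"
proof -
  have "l \<le> length u" if l: "l \<in> C" for l
  proof -
    obtain i :: "nat \<Rightarrow> nat" where i: "strict_mono_on {..<l} i" "\<forall>s<l. i s < length u"
      using l unfolding C_def by blast
    have "card (i ` {..<l}) = l" using i(1) by (simp add: card_image strict_mono_on_imp_inj_on)
    moreover have "card (i ` {..<l}) \<le> card {..<length u}" by (rule card_mono) (use i in auto)
    ultimately show ?thesis by simp
  qed
  then show "finite C" by (meson finite_nat_set_iff_bounded_le)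
  have "0 \<in> C" by (simp add: C_def strict_mono_on_def)
  then show "C \<noteq> {}" by blast
qed

lemma max_common_subwordE:
  fixes u w :: "'b list"
  obtains i j where "strict_mono_on {..<max_common_subword u w} i" "strict_mono_on {..<max_common_subword u w} j"
    "\<And>s. s < max_common_subword u w \<Longrightarrow> i s < length u \<and> j s < length w \<and> u ! i s = w ! j s"
proof -
  have "\<exists>i j. strict_mono_on {..<max_common_subword u w} i \<and> strict_mono_on {..<max_common_subword u w} j \<and>
     (\<forall>s<max_common_subword u w. i s < length u \<and> j s < length w \<and> u ! i s = w ! j s)"
    using Max_in[OF max_common_subword_set[of u w]] unfolding max_common_subword_def[symmetric] mem_Collect_eq .
  with that show ?thesis by (elim exE conjE) simp
qed

lemma order_match_edit_distance:
  assumes "edit_distance u w < e" "length u = n" "length w = n" "n > 0"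
  shows "order_match (\<lambda>i j. u ! i = w ! j) n ((1 - e) * real n)"
proof -
  let ?l = "max_common_subword u w"
  obtain i j where ij: "strict_mono_on {..<?l} i" "strict_mono_on {..<?l} j"
    "\<And>s. s < ?l \<Longrightarrow> i s < length u \<and> j s < length w \<and> u ! i s = w ! j s"
    using max_common_subwordE[of u w] by blast
  have lt: "(1 - e) * real n < real ?l"
    using assms unfolding edit_distance_def by (simp add: field_simps)
  have "inj_on i {..<?l}" using ij(1) by (rule strict_mono_on_imp_inj_on)
  then have inj: "inj_on (\<lambda>s. (i s, j s)) {..<?l}" by (auto simp: inj_on_def)
  show ?thesis
  proof (rule order_matchI[of "(\<lambda>s. (i s, j s)) ` {..<?l}"])
    show "(1 - e) * real n \<le> real (card ((\<lambda>s. (i s, j s)) ` {..<?l}))"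
      using lt by (simp add: card_image[OF inj])
    show "chain_rel ((\<lambda>s. (i s, j s)) ` {..<?l})"
      using strict_mono_on_less[OF ij(1)] strict_mono_on_less[OF ij(2)] by (auto simp: chain_rel_def)
  qed (use ij assms in auto)
qed

lemma strict_mono_on_nth_sorted_list_of_set:
  assumes "finite (A :: nat set)"
  shows "strict_mono_on {..<card A} ((!) (sorted_list_of_set A))"
proof (rule strict_mono_onI)
  fix r s assume "r \<in> {..<card A}" "s \<in> {..<card A}" "r < s"
  then show "sorted_list_of_set A ! r < sorted_list_of_set A ! s"
    by (intro sorted_wrt_nth_less[OF strict_sorted_list_of_set]) auto
qed

lemma edit_distance_le_order_match:
  assumes m: "order_match (\<lambda>i j. u ! i = w ! j) n k" and len: "length u = n" "length w = n" "n > 0"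
  shows "edit_distance u w \<le> 1 - k / real n"
proof -
  obtain S where S: "S \<subseteq> {..<n} \<times> {..<n}" "finite S" "chain_rel S" "\<forall>i j. (i, j) \<in> S \<longrightarrow> u ! i = w ! j" "k \<le> real (card S)"
    using m by (rule order_matchE)
  \<comment> \<open>The left indices are listed in increasing order; the chain condition then makes
    their partners increase too.\<close>
  define i where "i = (!) (sorted_list_of_set (fst ` S))"
  define j where "j = (\<lambda>s. THE j. (i s, j) \<in> S)"
  have c: "card (fst ` S) = card S" by (rule card_image[OF inj_on_fst_chain[OF S(3)]])
  have i: "strict_mono_on {..<card S} i"
    unfolding i_def using strict_mono_on_nth_sorted_list_of_set[of "fst ` S"] S(2) c by simp
  have ij: "(i s, j s) \<in> S" if "s < card S" for s
  proof -
    have "i s \<in> fst ` S"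
      unfolding i_def using that S(2) c
      by (metis finite_imageI length_sorted_list_of_set nth_mem set_sorted_list_of_set)
    then obtain t where t: "(i s, t) \<in> S" by auto
    then show ?thesis unfolding j_def by (rule theI) (use t chain_rel_eq[OF S(3)] in blast)
  qed
  have j: "strict_mono_on {..<card S} j"
  proof (rule strict_mono_onI)
    fix r s assume rs: "r \<in> {..<card S}" "s \<in> {..<card S}" "r < s"
    then have "i r < i s" using i by (auto simp: strict_mono_on_def)
    then show "j r < j s" using chain_relD[OF S(3) ij ij] rs by auto
  qed
  have "card S \<le> max_common_subword u w"
    unfolding max_common_subword_def
  proof (rule Max_ge[OF max_common_subword_set(1)])
    have "\<forall>s<card S. i s < length u \<and> j s < length w \<and> u ! i s = w ! j s"
    proof (intro allI impI)
      fix s assume "s < card S"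
      from ij[OF this] show "i s < length u \<and> j s < length w \<and> u ! i s = w ! j s"
        using subsetD[OF S(1)] S(4) len by auto
    qed
    then show "card S \<in> {l. \<exists>i j. strict_mono_on {..<l} i \<and> strict_mono_on {..<l} j \<and>
        (\<forall>s<l. i s < length u \<and> j s < length w \<and> u ! i s = w ! j s)}"
      using i j by blast
  qed
  then have "k \<le> real (max_common_subword u w)" using S(5) by linarith
  then show ?thesis using len by (simp add: edit_distance_def divide_right_mono)
qed

section \<open>Generic sequences and regularity\<close>

lemma borel_probD:
  assumes "borel_prob \<mu>"
  shows "prob_space \<mu>" "sets \<mu> = sets borel" "space \<mu> = UNIV"
  using assms by (auto simp: borel_prob_def dest: sets_eq_imp_space_eq)

lemma integral_empirical_measure:
  fixes f :: "'a::topological_space \<Rightarrow> real"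
  assumes "f \<in> borel_measurable borel"
  shows "integral\<^sup>L (empirical_measure x n) f = (\<Sum>i<n. f (x i)) / real n"
proof -
  have "x \<in> measurable (uniform_count_measure {..<n}) borel"
    by (simp add: measurable_def space_uniform_count_measure sets_uniform_count_measure)
  then show ?thesis
    unfolding empirical_measure_def using assms
    by (simp add: integral_distr integral_uniform_count_measure)
qed

text \<open>The continuous functions \<open>max 0 (1 - k * infdist x F)\<close> decrease to the indicator of \<open>F\<close>.\<close>

lemma closed_measure_approx:
  fixes F :: "'a::metric_space set"
  assumes \<mu>: "borel_prob \<mu>" and F: "closed F" and c: "measure \<mu> F < c"
  obtains f :: "'a \<Rightarrow> real" where "continuous_on UNIV f" "\<And>x. indicator F x \<le> f x" "integral\<^sup>L \<mu> f < c"
proof (cases "F = {}")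
  case True
  with that[of "\<lambda>_. 0"] c show ?thesis by auto
next
  case False
  interpret prob_space \<mu> using borel_probD[OF \<mu>] by simp
  have sets: "sets \<mu> = sets borel" and space: "space \<mu> = UNIV" using borel_probD[OF \<mu>] by auto
  define f where "f = (\<lambda>k x. max 0 (1 - real k * infdist x F))"
  have cont: "continuous_on UNIV (f k)" for k
    unfolding f_def by (intro continuous_intros)
  then have meas: "f k \<in> borel_measurable \<mu>" for k
    using borel_measurable_continuous_onI sets by (metis measurable_cong_sets)
  have "(\<lambda>k. integral\<^sup>L \<mu> (f k)) \<longlonglongrightarrow> integral\<^sup>L \<mu> (indicator F :: 'a \<Rightarrow> real)"
  proof (rule integral_dominated_convergence[where w = "\<lambda>_. 1"])
    show "(indicator F :: 'a \<Rightarrow> real) \<in> borel_measurable \<mu>"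
      using F sets by (intro borel_measurable_indicator) auto
    show "AE x in \<mu>. (\<lambda>k. f k x) \<longlonglongrightarrow> indicator F x"
    proof (rule AE_I2)
      fix x
      show "(\<lambda>k. f k x) \<longlonglongrightarrow> indicator F x"
      proof (cases "x \<in> F")
        case True
        then show ?thesis by (simp add: f_def)
      next
        case x: False
        then have pos: "infdist x F > 0" using F False by (intro infdist_pos_not_in_closed)
        obtain K where K: "1 < real K * infdist x F" using pos reals_Archimedean3 by blast
        have "f k x = 0" if "k \<ge> K" for k
        proof -
          have "real K * infdist x F \<le> real k * infdist x F" using that pos by (intro mult_right_mono) auto
          then show ?thesis using K by (simp add: f_def)
        qed
        then show ?thesis using x
          by (intro tendsto_eventually eventually_sequentiallyI[of K]) auto
      qed
    qed
    show "AE x in \<mu>. norm (f k x) \<le> 1" for k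
      by (rule AE_I2) (simp add: f_def infdist_nonneg)
  qed (use meas in auto)
  moreover have "integral\<^sup>L \<mu> (indicator F :: 'a \<Rightarrow> real) = measure \<mu> F" using space by simp
  ultimately have "\<forall>\<^sub>F k in sequentially. integral\<^sup>L \<mu> (f k) < c" using c by (intro order_tendstoD) auto
  then obtain k where k: "integral\<^sup>L \<mu> (f k) < c" by (auto simp: eventually_sequentially)
  have "indicator F x \<le> f k x" for x by (auto simp: f_def indicator_def)
  with that[of "f k"] cont k show ?thesis by blast
qed

text \<open>Upper half of the portmanteau theorem in counting form: a continuous majorant of the
  indicator with integral below \<open>c\<close> eventually has empirical averages below
  \<open>c\<close>.\<close>

lemma generic_seq_closed:
  fixes F :: "'a::metric_space set"
  assumes z: "generic_seq z \<mu>" and F: "closed F" and c: "measure \<mu> F < c"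
  shows "\<forall>\<^sub>F N in sequentially. real (card {i. i < N \<and> z i \<in> F}) < c * real N"
proof -
  have \<mu>: "borel_prob \<mu>" using z by (simp add: generic_seq_def)
  obtain f where f: "continuous_on UNIV f" "\<And>x. indicator F x \<le> f x" "integral\<^sup>L \<mu> f < c"
    using closed_measure_approx[OF \<mu> F c] by blast
  have "(\<lambda>N. integral\<^sup>L (empirical_measure z N) f) \<longlonglongrightarrow> integral\<^sup>L \<mu> f"
    using z f by (auto simp: generic_seq_def weak_star_tendsto_def)
  then have "\<forall>\<^sub>F N in sequentially. integral\<^sup>L (empirical_measure z N) f < c"
    using f by (intro order_tendstoD) auto
  then show ?thesis using eventually_gt_at_top[of 0]
  proof eventually_elim
    case (elim N)
    have "real (card {i. i < N \<and> z i \<in> F}) = (\<Sum>i<N. indicator F (z i))"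
      by (simp add: indicator_def sum.If_cases Int_def lessThan_def)
    also have "\<dots> \<le> (\<Sum>i<N. f (z i))" by (intro sum_mono f)
    also have "\<dots> = integral\<^sup>L (empirical_measure z N) f * real N"
      using f(1) elim by (simp add: integral_empirical_measure borel_measurable_continuous_onI)
    also have "\<dots> < c * real N" using elim by (intro mult_strict_right_mono) auto
    finally show ?case .
  qed
qed

lemma generic_seq_open:
  fixes U :: "'a::metric_space set"
  assumes z: "generic_seq z \<mu>" and U: "open U" and c: "c < measure \<mu> U"
  shows "\<forall>\<^sub>F N in sequentially. real (card {i. i < N \<and> z i \<notin> U}) < (1 - c) * real N"
proof -
  have \<mu>: "borel_prob \<mu>" using z by (simp add: generic_seq_def)
  interpret prob_space \<mu> using borel_probD[OF \<mu>] by simp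
  have "measure \<mu> (- U) = 1 - measure \<mu> U"
    using prob_compl[of U] U borel_probD[OF \<mu>] by (simp add: Compl_eq_Diff_UNIV)
  then show ?thesis using generic_seq_closed[OF z, of "- U" "1 - c"] U c by auto
qed

text \<open>Induction over the sigma-algebra generated by the open sets. Inner approximation alone
  does not pass to complements, so the induction runs with \<open>R\<close>, which squeezes a set
  between a closed and an open one.\<close>

lemma closed_inner_regular:
  fixes A :: "'a::metric_space set"
  assumes \<mu>: "borel_prob \<mu>" and A: "A \<in> sets borel" and "\<epsilon> > 0"
  obtains K where "closed K" "K \<subseteq> A" "measure \<mu> (A - K) < \<epsilon>"
proof -
  interpret prob_space \<mu> using borel_probD[OF \<mu>] by simp
  have sets[simp]: "sets \<mu> = sets borel" and space: "space \<mu> = UNIV" using borel_probD[OF \<mu>] by auto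
  define R where "R = (\<lambda>A. \<forall>\<epsilon>>0. \<exists>K U. closed K \<and> open U \<and> K \<subseteq> A \<and> A \<subseteq> U \<and> measure \<mu> (U - K) < \<epsilon>)"
  have R_open: "R G" if G: "open G" for G
    unfolding R_def
  proof (intro allI impI)
    fix \<epsilon> :: real assume "\<epsilon> > 0"
    obtain F :: "nat \<Rightarrow> 'a set" where F: "\<And>n. closed (F n)" "(\<Union>n. F n) = G" "incseq F"
    proof -
      define F where "F = (\<lambda>n. {x. 1 / real (Suc n) \<le> infdist x (- G)})"
      show ?thesis
      proof (cases "- G = {}")
        \<comment> \<open>\<open>infdist\<close> to the empty set is 0 by convention, which would
          make the sets \<open>F n\<close> empty although \<open>G\<close> is the whole
          space.\<close>
        case True
        then show ?thesis using that[of "\<lambda>_. UNIV"] by (auto simp: incseq_def)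
      next
        case False
        have 1: "closed (F n)" for n
          unfolding F_def by (intro closed_Collect_le continuous_intros)
        have 2: "(\<Union>n. F n) = G"
        proof safe
          fix x n assume "x \<in> F n"
          then have "0 < infdist x (- G)"
            unfolding F_def by (auto intro: less_le_trans[of 0 "1 / real (Suc n)"] simp del: of_nat_Suc)
          then show "x \<in> G" by (cases "x \<in> G") auto
        next
          fix x assume "x \<in> G"
          then have "infdist x (- G) > 0" using G False by (intro infdist_pos_not_in_closed) auto
          then obtain n where "1 / real (Suc n) < infdist x (- G)" using nat_approx_posE by blast
          then show "x \<in> (\<Union>n. F n)" by (auto simp: F_def intro: less_imp_le)
        qed
        have 3: "incseq F"
          unfolding incseq_def
        proof (intro allI impI subsetI)
          fix m n x assume "m \<le> (n::nat)" "x \<in> F m"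
          then have "1 / real (Suc n) \<le> 1 / real (Suc m)" "1 / real (Suc m) \<le> infdist x (- G)"
            by (auto simp: F_def frac_le)
          then show "x \<in> F n" by (simp add: F_def)
        qed
        show ?thesis using that 1 2 3 by blast
      qed
    qed
    have "(\<lambda>n. measure \<mu> (F n)) \<longlonglongrightarrow> measure \<mu> (\<Union>n. F n)"
      by (rule finite_Lim_measure_incseq) (use F in auto)
    then have "\<forall>\<^sub>F n in sequentially. measure \<mu> G - \<epsilon> < measure \<mu> (F n)"
      using \<open>\<epsilon> > 0\<close> F(2) by (intro order_tendstoD) auto
    then obtain n where "measure \<mu> G - \<epsilon> < measure \<mu> (F n)" by (auto simp: eventually_sequentially)
    moreover have "measure \<mu> (G - F n) = measure \<mu> G - measure \<mu> (F n)"
      by (rule finite_measure_Diff) (use G F in auto)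
    ultimately show "\<exists>K U. closed K \<and> open U \<and> K \<subseteq> G \<and> G \<subseteq> U \<and> measure \<mu> (U - K) < \<epsilon>"
      using G F by (intro exI[of _ "F n"] exI[of _ G]) auto
  qed
  have R_compl: "R (- B)" if RB: "R B" for B
    unfolding R_def
  proof (intro allI impI)
    fix \<epsilon> :: real assume "\<epsilon> > 0"
    obtain K U where "closed K" "open U" "K \<subseteq> B" "B \<subseteq> U" "measure \<mu> (U - K) < \<epsilon>"
      using RB[unfolded R_def, rule_format, OF \<open>\<epsilon> > 0\<close>] by (elim exE conjE)
    moreover have "- K - - U = U - K" by auto
    ultimately show "\<exists>K U. closed K \<and> open U \<and> K \<subseteq> - B \<and> - B \<subseteq> U \<and> measure \<mu> (U - K) < \<epsilon>"
      by (intro exI[of _ "- U"] exI[of _ "- K"]) auto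
  qed
  have R_Union: "R (\<Union>n. B n)" if B: "\<And>n::nat. R (B n)" for B
    unfolding R_def
  proof (intro allI impI)
    fix \<epsilon> :: real assume "\<epsilon> > 0"
    \<comment> \<open>Geometric weights spend one half of \<epsilon> on all the approximations
      together; the other half is kept for the passage to \<open>KK\<close>.\<close>
    then have pos: "\<epsilon> / 2 * (1 / 2) ^ Suc n > 0" for n :: nat by simp
    have "\<exists>K U. closed K \<and> open U \<and> K \<subseteq> B n \<and> B n \<subseteq> U \<and> measure \<mu> (U - K) < \<epsilon> / 2 * (1 / 2) ^ Suc n" for n
      by (rule B[unfolded R_def, rule_format, OF pos])
    then obtain K U where KU: "\<And>n. closed (K n)" "\<And>n. open (U n)" "\<And>n. K n \<subseteq> B n" "\<And>n. B n \<subseteq> U n"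
      "\<And>n. measure \<mu> (U n - K n) < \<epsilon> / 2 * (1 / 2) ^ Suc n" by metis
    have geo: "(\<lambda>n. \<epsilon> / 2 * (1 / 2) ^ Suc n) sums (\<epsilon> / 2)"
      using sums_mult[OF power_half_series, of "\<epsilon> / 2"] by simp
    have "measure \<mu> (\<Union>n. U n - K n) \<le> (\<Sum>n. measure \<mu> (U n - K n))"
    proof (rule finite_measure_subadditive_countably)
      show "range (\<lambda>n. U n - K n) \<subseteq> sets \<mu>" using KU by auto
      show "summable (\<lambda>n. measure \<mu> (U n - K n))"
        by (rule summable_comparison_test'[OF sums_summable[OF geo], of 0]) (use KU(5) in \<open>auto intro: less_imp_le\<close>)
    qed
    also have "\<dots> \<le> \<epsilon> / 2"
    proof -
      have "summable (\<lambda>n. measure \<mu> (U n - K n))"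
        by (rule summable_comparison_test'[OF sums_summable[OF geo], of 0]) (use KU(5) in \<open>auto intro: less_imp_le\<close>)
      then have "(\<Sum>n. measure \<mu> (U n - K n)) \<le> (\<Sum>n. \<epsilon> / 2 * (1 / 2) ^ Suc n)"
        by (intro suminf_le) (use KU(5) geo sums_summable in \<open>auto intro: less_imp_le\<close>)
      then show ?thesis using sums_unique[OF geo] by simp
    qed
    finally have le: "measure \<mu> (\<Union>n. U n - K n) \<le> \<epsilon> / 2" .
    \<comment> \<open>The union of all \<open>K n\<close> need not be closed, but its finite partial
      unions are and exhaust its measure.\<close>
    define KK where "KK = (\<lambda>n. \<Union>i\<le>n. K i)"
    have cl: "closed (KK n)" for n using KU(1) by (auto simp: KK_def)
    have "(\<lambda>n. measure \<mu> (KK n)) \<longlonglongrightarrow> measure \<mu> (\<Union>n. KK n)"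
      by (rule finite_Lim_measure_incseq) (use cl in \<open>auto simp: incseq_def KK_def\<close>, force)
    then have "\<forall>\<^sub>F n in sequentially. measure \<mu> (\<Union>n. KK n) - \<epsilon> / 2 < measure \<mu> (KK n)"
      using \<open>\<epsilon> > 0\<close> by (intro order_tendstoD) auto
    then obtain n where n: "measure \<mu> (\<Union>n. KK n) - \<epsilon> / 2 < measure \<mu> (KK n)" by (auto simp: eventually_sequentially)
    have UKK: "(\<Union>n. KK n) = (\<Union>n. K n)" by (auto simp: KK_def)
    have "measure \<mu> ((\<Union>n. U n) - KK n) \<le> measure \<mu> ((\<Union>n. U n - K n) \<union> ((\<Union>n. KK n) - KK n))"
      by (rule finite_measure_mono) (use KU cl in \<open>auto simp: UKK\<close>)
    also have "\<dots> \<le> measure \<mu> (\<Union>n. U n - K n) + measure \<mu> ((\<Union>n. KK n) - KK n)"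
      by (rule measure_Un_le) (use KU cl in auto)
    also have "measure \<mu> ((\<Union>n. KK n) - KK n) = measure \<mu> (\<Union>n. KK n) - measure \<mu> (KK n)"
      by (rule finite_measure_Diff) (use cl in auto)
    finally have "measure \<mu> ((\<Union>n. U n) - KK n) < \<epsilon>" using le n by linarith
    moreover have "KK n \<subseteq> (\<Union>n. B n)" "(\<Union>n. B n) \<subseteq> (\<Union>n. U n)"
      using KU(3) UN_mono[of UNIV UNIV B U] KU(4) by (auto simp: KK_def)
    ultimately show "\<exists>K U. closed K \<and> open U \<and> K \<subseteq> (\<Union>n. B n) \<and> (\<Union>n. B n) \<subseteq> U \<and> measure \<mu> (U - K) < \<epsilon>"
      using cl KU(2) by (intro exI[of _ "KK n"] exI[of _ "\<Union>n. U n"]) auto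
  qed
  have "A \<in> sigma_sets UNIV {S. open S}" using A by (simp add: borel_def sets_measure_of)
  then have "R A"
  proof induction
    case (Basic a) then show ?case using R_open by simp
  next
    case Empty show ?case using R_open by simp
  next
    case (Compl a) then show ?case using R_compl by (simp add: Compl_eq_Diff_UNIV)
  next
    case (Union a) then show ?case using R_Union by simp
  qed
  then obtain K U where K: "closed K" "open U" "K \<subseteq> A" "A \<subseteq> U" "measure \<mu> (U - K) < \<epsilon>"
    using \<open>\<epsilon> > 0\<close> unfolding R_def by (elim allE impE exE conjE)
  have "measure \<mu> (A - K) \<le> measure \<mu> (U - K)" by (rule finite_measure_mono) (use K in auto)
  with K that show ?thesis by force
qed

section \<open>Names and entropy\<close>

definition cell :: "'a set set \<Rightarrow> 'a \<Rightarrow> 'a set" where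
  "cell P x = (THE p. p \<in> P \<and> x \<in> p)"

definition word_at :: "('a \<Rightarrow> 'a) \<Rightarrow> 'a set set \<Rightarrow> nat \<Rightarrow> 'a \<Rightarrow> 'a set list" where
  "word_at T P n x = map (\<lambda>j. cell P ((T ^^ j) x)) [0..<n]"

lemma cell_eq:
  assumes "partition_on UNIV P" "p \<in> P" "x \<in> p"
  shows "cell P x = p"
  unfolding cell_def
  by (rule the_equality) (use assms in \<open>auto simp: partition_on_def disjoint_def\<close>)

lemma cell_in:
  assumes "partition_on UNIV P"
  shows "cell P x \<in> P" "x \<in> cell P x"
proof -
  obtain p where "p \<in> P" "x \<in> p" using assms by (auto simp: partition_on_def)
  then show "cell P x \<in> P" "x \<in> cell P x" using cell_eq[OF assms] by auto
qed

lemma length_word_at [simp]: "length (word_at T P n x) = n"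
  by (simp add: word_at_def)

lemma nth_word_at [simp]: "j < n \<Longrightarrow> word_at T P n x ! j = cell P ((T ^^ j) x)"
  by (simp add: word_at_def)

lemma word_at_in_join_words:
  assumes "partition_on UNIV P"
  shows "x \<in> atom_of T (word_at T P n x)" "word_at T P n x \<in> join_words T P n"
proof -
  show "x \<in> atom_of T (word_at T P n x)" using cell_in[OF assms] by (simp add: atom_of_def)
  then show "word_at T P n x \<in> join_words T P n"
    using cell_in[OF assms] by (auto simp: join_words_def word_at_def)
qed

lemma atom_of_eq_word_at:
  assumes P: "partition_on UNIV P" and w: "w \<in> join_words T P n" and x: "x \<in> atom_of T w"
  shows "w = word_at T P n x"
proof (rule nth_equalityI)
  show len: "length w = length (word_at T P n x)" using w by (simp add: join_words_def)
  fix j assume j: "j < length w"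
  then have "w ! j \<in> P" "(T ^^ j) x \<in> w ! j" using w x by (auto simp: join_words_def atom_of_def)
  then show "w ! j = word_at T P n x ! j" using cell_eq[OF P] len j by simp
qed

lemma finite_join_words:
  assumes "finite P"
  shows "finite (join_words T P n)" "card (join_words T P n) \<le> card P ^ n"
proof -
  have sub: "join_words T P n \<subseteq> {w. set w \<subseteq> P \<and> length w = n}" by (auto simp: join_words_def)
  show "finite (join_words T P n)" by (rule finite_subset[OF sub finite_lists_length_eq[OF assms]])
  show "card (join_words T P n) \<le> card P ^ n"
    using card_mono[OF finite_lists_length_eq[OF assms] sub] by (simp add: card_lists_length_eq[OF assms])
qed

lemma inj_on_atom_of: "partition_on UNIV P \<Longrightarrow> inj_on (atom_of T) (join_words T P n)"
proof (rule inj_onI)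
  fix u w assume P: "partition_on UNIV P" and u: "u \<in> join_words T P n" and w: "w \<in> join_words T P n"
    and eq: "atom_of T u = atom_of T w"
  obtain x where "x \<in> atom_of T u" using u by (auto simp: join_words_def)
  then show "u = w" using atom_of_eq_word_at[OF P u] atom_of_eq_word_at[OF P w] eq by metis
qed

section \<open>Measurability of iterates and atoms\<close>

lemma continuous_on_funpow:
  fixes T :: "'a::topological_space \<Rightarrow> 'a"
  assumes "continuous_on UNIV T"
  shows "continuous_on UNIV (T ^^ j)"
proof (induction j)
  case (Suc j)
  have "continuous_on UNIV (T \<circ> (T ^^ j))"
    by (rule continuous_on_compose[OF Suc continuous_on_subset[OF assms]]) simp
  then show ?case by simp
qed (simp add: id_def)

lemma measurable_funpow_borel:
  fixes T :: "'a::topological_space \<Rightarrow> 'a"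
  assumes "continuous_on UNIV T"
  shows "T ^^ j \<in> borel_measurable borel"
  by (rule borel_measurable_continuous_onI[OF continuous_on_funpow[OF assms]])

lemma atom_of_sets:
  fixes T :: "'a::topological_space \<Rightarrow> 'a"
  assumes T: "continuous_on UNIV T" and P: "P \<subseteq> sets borel" "set w \<subseteq> P"
  shows "atom_of T w \<in> sets borel"
proof -
  have "(T ^^ j) -` (w ! j) \<in> sets borel" if "j < length w" for j
  proof -
    have "w ! j \<in> sets borel" using P nth_mem[OF that] by auto
    then show ?thesis using measurable_sets[OF measurable_funpow_borel[OF T], of "w ! j" j] by simp
  qed
  then have "(\<Inter>j\<in>{..<length w}. (T ^^ j) -` (w ! j)) \<in> sets borel" if "w \<noteq> []"
    using that by (intro sets.finite_INT) auto
  moreover have "atom_of T w = (\<Inter>j\<in>{..<length w}. (T ^^ j) -` (w ! j))" by (auto simp: atom_of_def)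
  ultimately show ?thesis by (cases "w = []") (simp_all add: atom_of_def)
qed

text \<open>Gibbs' inequality against the uniform distribution on \<open>S\<close>: use
  \<open>ln x \<le> x - 1\<close> at \<open>x = 1 / (c * p i)\<close>. The masses need not add up to
  1; if their sum is \<open>s\<close>, the slack is \<open>1 - s\<close>, estimated by 1.\<close>

lemma entropy_sum_le:
  fixes p :: "'b \<Rightarrow> real"
  assumes "finite S" and p: "\<And>i. i \<in> S \<Longrightarrow> 0 \<le> p i"
  shows "(\<Sum>i\<in>S. - (p i * ln (p i))) \<le> 1 + (\<Sum>i\<in>S. p i) * ln (real (card S))"
proof (cases "S = {}")
  case False
  define c where "c = real (card S)"
  have c: "c > 0" using False \<open>finite S\<close> by (simp add: c_def card_gt_0_iff)
  have "- (p i * ln (p i)) \<le> 1 / c + p i * ln c" if "i \<in> S" for i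
  proof (cases "p i = 0")
    case True
    then show ?thesis using c by simp
  next
    case False
    then have pos: "p i > 0" using p[OF that] by simp
    have "ln (1 / (c * p i)) \<le> 1 / (c * p i) - 1" using pos c by (intro ln_le_minus_one) simp
    then have "p i * ln (1 / (c * p i)) \<le> p i * (1 / (c * p i) - 1)" using pos by (intro mult_left_mono) auto
    moreover have "ln (1 / (c * p i)) = - ln c - ln (p i)" using pos c by (simp add: ln_div ln_mult)
    moreover have "p i * (1 / (c * p i) - 1) = 1 / c - p i" using pos c by (simp add: field_simps)
    ultimately show ?thesis using pos by (simp add: algebra_simps)
  qed
  then have "(\<Sum>i\<in>S. - (p i * ln (p i))) \<le> (\<Sum>i\<in>S. 1 / c + p i * ln c)" by (rule sum_mono)
  also have "\<dots> = 1 + (\<Sum>i\<in>S. p i) * ln c"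
    using c by (simp add: sum.distrib sum_distrib_right c_def)
  finally show ?thesis by (simp add: c_def)
qed simp

text \<open>The names in \<open>A\<close> contribute at most \<open>1 + ln C\<close>. The others may
  be as many as \<open>card P ^ n\<close> but carry mass at most \<epsilon>, so they contribute at
  most \<open>1 + \<epsilon> * n * ln (card P)\<close>.\<close>

lemma join_partition_entropy_le:
  fixes T :: "'a::topological_space \<Rightarrow> 'a"
  assumes \<mu>: "borel_prob \<mu>" and T: "continuous_on UNIV T" and P: "finite_borel_partition P"
    and A: "A \<subseteq> join_words T P n" and mA: "measure \<mu> (\<Union>w\<in>A. atom_of T w) > 1 - \<epsilon>"
    and C: "real (card A) \<le> C" "1 \<le> C"
  shows "partition_entropy \<mu> (join_partition T P n) \<le> 2 + ln C + \<epsilon> * real n * ln (real (card P))"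
proof -
  interpret prob_space \<mu> using borel_probD[OF \<mu>] by simp
  have part: "partition_on UNIV P" and finP: "finite P" and PB: "P \<subseteq> sets borel"
    using P by (auto simp: finite_borel_partition_def)
  let ?J = "join_words T P n"
  define p where "p = (\<lambda>w. measure \<mu> (atom_of T w))"
  have finJ: "finite ?J" using finite_join_words[OF finP] by simp
  have atoms: "atom_of T w \<in> sets \<mu>" if "w \<in> ?J" for w
    using atom_of_sets[OF T PB, of w] that borel_probD[OF \<mu>] by (auto simp: join_words_def)
  have disj: "disjoint_family_on (atom_of T) ?J"
    unfolding disjoint_family_on_def using atom_of_eq_word_at[OF part] by blast
  have sum_p: "(\<Sum>w\<in>B. p w) = measure \<mu> (\<Union>w\<in>B. atom_of T w)" if "B \<subseteq> ?J" for B
    unfolding p_def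
    by (rule finite_measure_finite_Union[symmetric])
      (use that finJ atoms disj in \<open>auto intro: finite_subset disjoint_family_on_mono\<close>)
  have UJ: "(\<Union>w\<in>?J. atom_of T w) = UNIV" using word_at_in_join_words[OF part] by blast
  have sumJ: "(\<Sum>w\<in>?J. p w) = 1" using sum_p[of ?J] UJ prob_space borel_probD(3)[OF \<mu>] by simp
  have finA: "finite A" using A finJ by (rule finite_subset)
  have "(\<Sum>w\<in>A. p w) + (\<Sum>w\<in>?J - A. p w) = 1"
    using sumJ sum.subset_diff[OF A finJ, of p] by simp
  then have rest: "(\<Sum>w\<in>?J - A. p w) \<le> \<epsilon>" using mA sum_p[OF A] by simp
  have nonneg: "0 \<le> p w" for w by (simp add: p_def)
  have leA: "(\<Sum>w\<in>A. p w) \<le> 1" using sum_p[OF A] by simp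
  have "(\<Sum>w\<in>A. - (p w * ln (p w))) \<le> 1 + (\<Sum>w\<in>A. p w) * ln (real (card A))"
    by (rule entropy_sum_le[OF finA]) (rule nonneg)
  also have "(\<Sum>w\<in>A. p w) * ln (real (card A)) \<le> 1 * ln C"
  proof (cases "A = {}")
    case False
    then have "1 \<le> real (card A)" using finA by (simp add: Suc_le_eq card_gt_0_iff)
    then have "0 \<le> ln (real (card A))" "ln (real (card A)) \<le> ln C" using C by auto
    then show ?thesis using leA by (intro mult_mono) (auto intro: sum_nonneg nonneg)
  qed (use C in simp)
  finally have 1: "(\<Sum>w\<in>A. - (p w * ln (p w))) \<le> 1 + ln C" by simp
  have P1: "1 \<le> real (card P)"
  proof -
    have "P \<noteq> {}" using part by (auto simp: partition_on_def)
    then show ?thesis using finP by (simp add: Suc_le_eq card_gt_0_iff)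
  qed
  have ln_pow: "ln (real (card P ^ n)) = real n * ln (real (card P))" using P1 by (simp add: ln_realpow)
  have "(\<Sum>w\<in>?J - A. - (p w * ln (p w))) \<le> 1 + (\<Sum>w\<in>?J - A. p w) * ln (real (card (?J - A)))"
    by (rule entropy_sum_le) (use finJ nonneg in auto)
  also have "(\<Sum>w\<in>?J - A. p w) * ln (real (card (?J - A))) \<le> \<epsilon> * (real n * ln (real (card P)))"
  proof (cases "?J - A = {}")
    case False
    then have "1 \<le> real (card (?J - A))" using finJ by (simp add: Suc_le_eq card_gt_0_iff del: Diff_eq_empty_iff)
    moreover have "card (?J - A) \<le> card P ^ n"
      using card_mono[OF finJ, of "?J - A"] finite_join_words(2)[OF finP, of T n] by auto
    ultimately have "0 \<le> ln (real (card (?J - A)))" "ln (real (card (?J - A))) \<le> ln (real (card P ^ n))"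
      by (auto intro!: ln_mono simp del: of_nat_power)
    then show ?thesis using rest unfolding ln_pow
      by (intro mult_mono) (auto intro!: sum_nonneg nonneg intro: order_trans[OF sum_nonneg rest])
  next
    case True
    then have "0 \<le> \<epsilon>" using rest by (simp only: sum.empty)
    then show ?thesis unfolding True using P1 by simp
  qed
  finally have 2: "(\<Sum>w\<in>?J - A. - (p w * ln (p w))) \<le> 1 + \<epsilon> * real n * ln (real (card P))" by simp
  have "partition_entropy \<mu> (join_partition T P n) = (\<Sum>w\<in>?J. - (p w * ln (p w)))"
    unfolding partition_entropy_def join_partition_def p_def
    by (simp add: sum.reindex[OF inj_on_atom_of[OF part]] sum_negf)
  also have "\<dots> = (\<Sum>w\<in>?J - A. - (p w * ln (p w))) + (\<Sum>w\<in>A. - (p w * ln (p w)))"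
    by (rule sum.subset_diff[OF A finJ])
  finally show ?thesis using 1 2 by linarith
qed

lemma partition_entropy_nonneg:
  assumes "prob_space \<mu>"
  shows "0 \<le> partition_entropy \<mu> Q"
proof -
  interpret prob_space \<mu> by fact
  have "measure \<mu> B * ln (measure \<mu> B) \<le> 0" for B
    by (cases "measure \<mu> B = 0") (auto intro!: mult_nonneg_nonpos simp: zero_less_measure_iff)
  then show ?thesis unfolding partition_entropy_def by (simp add: sum_nonpos)
qed

text \<open>Give \<open>I\<close> the weight \<open>t\<close> to the power of the size of its
  complement. All subsets together weigh \<open>(1 + t) ^ n\<close>, by expanding the product, and
  each counted one weighs at least \<open>t powr a\<close> because \<open>t < 1\<close>. With
  \<open>t = e\<close> and \<open>a = e * n\<close> the exponential growth rate vanishes as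
  \<open>e\<close> tends to 0.\<close>

lemma card_large_subsets_le:
  fixes t :: real
  assumes t: "0 < t" "t < 1"
  shows "real (card {I. I \<subseteq> {..<n} \<and> real (n - card I) < a}) \<le> (1 + t) ^ n * t powr (- a)"
proof -
  let ?K = "{I. I \<subseteq> {..<n} \<and> real (n - card I) < a}"
  have sub: "?K \<subseteq> Pow {..<n}" by auto
  have "real (card ?K) * t powr a = (\<Sum>I\<in>?K. t powr a)" by simp
  also have "\<dots> \<le> (\<Sum>I\<in>?K. t ^ card ({..<n} - I))"
  proof (rule sum_mono)
    fix I assume I: "I \<in> ?K"
    then have "card ({..<n} - I) = n - card I" by (subst card_Diff_subset) (auto intro: finite_subset)
    then have "t powr a \<le> t powr (real (card ({..<n} - I)))"
      using t I by (intro powr_mono') auto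
    then show "t powr a \<le> t ^ card ({..<n} - I)" using t by (simp add: powr_realpow)
  qed
  also have "\<dots> \<le> (\<Sum>I\<in>Pow {..<n}. t ^ card ({..<n} - I))"
    by (rule sum_mono2) (use t sub in auto)
  also have "\<dots> = (\<Prod>x\<in>{..<n}. 1 + t)"
    by (subst prod_add) simp_all
  finally have "real (card ?K) * t powr a \<le> (1 + t) ^ n" by simp
  then show ?thesis using t by (simp add: powr_minus field_simps)
qed

text \<open>The values of an increasing enumeration form the sorted list of its image, so the image
  determines everything.\<close>

lemma strict_mono_on_lessThan_eq:
  fixes i i' :: "nat \<Rightarrow> nat"
  assumes "strict_mono_on {..<l} i" "strict_mono_on {..<l'} i'" "i ` {..<l} = i' ` {..<l'}"
  shows "l = l'" "\<And>s. s < l \<Longrightarrow> i s = i' s"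
proof -
  have sl: "sorted_list_of_set (i ` {..<l}) = map i [0..<l]" if "strict_mono_on {..<l} i" for l and i :: "nat \<Rightarrow> nat"
  proof (rule sorted_list_of_set_unique[THEN iffD1, of "i ` {..<l}" "map i [0..<l]", simplified])
    show "sorted_wrt (<) (map i [0..<l]) \<and> i ` {0..<l} = i ` {..<l} \<and> l = card (i ` {..<l})"
      using that strict_mono_on_imp_inj_on[OF that]
      by (auto simp: sorted_wrt_map sorted_wrt_upt card_image lessThan_atLeast0 strict_mono_on_def sorted_wrt_iff_nth_less)
  qed
  have eq: "map i [0..<l] = map i' [0..<l']" using sl[OF assms(1)] sl[OF assms(2)] assms(3) by simp
  then show "l = l'" by (metis length_map length_upt minus_nat.diff_0)
  then show "\<And>s. s < l \<Longrightarrow> i s = i' s" using eq by (metis add.left_neutral length_upt minus_nat.diff_0 nth_map nth_upt)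
qed

text \<open>A word at small edit distance from \<open>u\<close> is determined by the two index sets of a longest
  common subword together with its letters outside the second one.\<close>

lemma card_edit_ball_le:
  fixes u :: "'b list" and t :: real
  assumes P: "finite P" "P \<noteq> {}" and n: "n > 0" "length u = n" and t: "0 < t" "t < 1"
    and A: "\<And>w. w \<in> A \<Longrightarrow> length w = n \<and> set w \<subseteq> P \<and> edit_distance u w < e"
  shows "real (card A) \<le> ((1 + t) ^ n * t powr (- (e * real n)))\<^sup>2 * real (card P) powr (e * real n)"
proof -
  define K where "K = {I. I \<subseteq> {..<n} \<and> real (n - card I) < e * real n}"
  have finK: "finite K" unfolding K_def by (rule finite_subset[of _ "Pow {..<n}"]) auto
  have cK: "real (card K) \<le> (1 + t) ^ n * t powr (- (e * real n))"
    unfolding K_def using card_large_subsets_le[OF t, of n "e * real n"] .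
  let ?l = "\<lambda>w. max_common_subword u w"
  have "\<exists>i j. strict_mono_on {..<?l w} i \<and> strict_mono_on {..<?l w} j \<and>
     (\<forall>s<?l w. i s < length u \<and> j s < length w \<and> u ! i s = w ! j s)" for w
    using max_common_subwordE[of u w] by metis
  then obtain i j where ij: "\<And>w. strict_mono_on {..<?l w} (i w)" "\<And>w. strict_mono_on {..<?l w} (j w)"
     "\<And>w s. s < ?l w \<Longrightarrow> i w s < length u \<and> j w s < length w \<and> u ! i w s = w ! j w s"
    by metis
  define I where "I = (\<lambda>w. i w ` {..<?l w})"
  define J where "J = (\<lambda>w. j w ` {..<?l w})"
  have cI: "card (I w) = ?l w" "card (J w) = ?l w" for w
    unfolding I_def J_def using ij by (auto simp: card_image strict_mono_on_imp_inj_on)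
  have IJ: "I w \<in> K" "J w \<in> K" if w: "w \<in> A" for w
  proof -
    have len: "length w = n" using A[OF w] by simp
    have sub: "I w \<subseteq> {..<n}" "J w \<subseteq> {..<n}"
      using ij(3)[of _ w] unfolding I_def J_def len n(2) by auto
    then have "?l w \<le> n" using cI(1)[of w] card_mono[of "{..<n}" "I w"] by simp
    moreover have "real n - real (?l w) < e * real n"
      using A[OF w] n by (simp add: edit_distance_def field_simps)
    ultimately have "real (n - ?l w) < e * real n" by (simp add: of_nat_diff)
    then show "I w \<in> K" "J w \<in> K" using sub cI by (auto simp: K_def)
  qed
  define \<phi> where "\<phi> = (\<lambda>w. (I w, J w, restrict ((!) w) ({..<n} - J w)))"
  define Z where "Z = (SIGMA I:K. SIGMA J:K. ({..<n} - J) \<rightarrow>\<^sub>E P)"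
  have "inj_on \<phi> A"
  proof (rule inj_onI)
    fix w w' assume w: "w \<in> A" "w' \<in> A" and eq: "\<phi> w = \<phi> w'"
    have "i w ` {..<?l w} = i w' ` {..<?l w'}" "j w ` {..<?l w} = j w' ` {..<?l w'}"
      using eq by (auto simp: \<phi>_def I_def J_def)
    note same = strict_mono_on_lessThan_eq[OF ij(1) ij(1) this(1)] strict_mono_on_lessThan_eq[OF ij(2) ij(2) this(2)]
    have r: "restrict ((!) w) ({..<n} - J w) = restrict ((!) w') ({..<n} - J w)" "J w' = J w"
      using eq by (auto simp: \<phi>_def)
    show "w = w'"
    proof (rule nth_equalityI)
      show "length w = length w'" using A w by simp
      fix k assume k: "k < length w"
      show "w ! k = w' ! k"
      proof (cases "k \<in> J w")
        case True
        then obtain s where s: "s < ?l w" "k = j w s" by (auto simp: J_def)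
        then show ?thesis using ij(3)[of s w] ij(3)[of s w'] same by metis
      next
        case False
        then show ?thesis using fun_cong[OF r(1), of k] k A[OF w(1)] by simp
      qed
    qed
  qed
  moreover have "\<phi> ` A \<subseteq> Z"
  proof
    fix v assume "v \<in> \<phi> ` A"
    then obtain w where w: "w \<in> A" "v = \<phi> w" by auto
    have "w ! k \<in> P" if "k < n" for k using A[OF w(1)] nth_mem[of k w] that by auto
    then have "restrict ((!) w) ({..<n} - J w) \<in> ({..<n} - J w) \<rightarrow>\<^sub>E P" by auto
    then show "v \<in> Z" using IJ[OF w(1)] w(2) by (simp add: Z_def \<phi>_def)
  qed
  moreover have fin: "finite Z"
    unfolding Z_def using finK P by (intro finite_SigmaI finite_PiE) auto
  ultimately have "card A \<le> card Z" by (intro card_inj_on_le)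
  also have "card Z = card K * (\<Sum>J\<in>K. card P ^ card ({..<n} - J))"
  proof -
    have fin1: "finite (({..<n} - J) \<rightarrow>\<^sub>E P)" for J using P by (intro finite_PiE) auto
    have c1: "card (({..<n} - J) \<rightarrow>\<^sub>E P) = card P ^ card ({..<n} - J)" for J
      by (simp add: card_PiE)
    have "card (SIGMA J:K. ({..<n} - J) \<rightarrow>\<^sub>E P) = (\<Sum>J\<in>K. card P ^ card ({..<n} - J))"
      using finK fin1 by (simp add: card_SigmaI c1)
    moreover have "finite (SIGMA J:K. ({..<n} - J) \<rightarrow>\<^sub>E P)" using finK fin1 by (intro finite_SigmaI)
    ultimately show ?thesis unfolding Z_def using finK by (simp add: card_SigmaI)
  qed
  finally have "real (card A) \<le> real (card K * (\<Sum>J\<in>K. card P ^ card ({..<n} - J)))"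
    by (rule of_nat_mono)
  then have "real (card A) \<le> real (card K) * (\<Sum>J\<in>K. real (card P) ^ card ({..<n} - J))"
    by simp
  also have "\<dots> \<le> real (card K) * (\<Sum>J\<in>K. real (card P) powr (e * real n))"
  proof (intro mult_left_mono sum_mono)
    fix J assume J: "J \<in> K"
    have P1: "1 \<le> real (card P)" using P by (simp add: Suc_le_eq card_gt_0_iff)
    have "card ({..<n} - J) = n - card J" using J by (subst card_Diff_subset) (auto simp: K_def intro: finite_subset)
    then have "real (card P) powr real (card ({..<n} - J)) \<le> real (card P) powr (e * real n)"
      using J P1 by (intro powr_mono) (auto simp: K_def)
    then show "real (card P) ^ card ({..<n} - J) \<le> real (card P) powr (e * real n)"
      using P1 by (simp add: powr_realpow)
  qed simp
  also have "\<dots> = (real (card K))\<^sup>2 * real (card P) powr (e * real n)" by (simp add: power2_eq_square)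
  also have "\<dots> \<le> ((1 + t) ^ n * t powr (- (e * real n)))\<^sup>2 * real (card P) powr (e * real n)"
    using cK by (intro mult_right_mono power_mono) auto
  finally show ?thesis .
qed

text \<open>All large \<open>n\<close>, not some \<open>n\<close> as in
  \<open>loosely_kronecker\<close>: the upper limit in the entropy sees every large length.\<close>

definition eventually_alike :: "('a::topological_space \<Rightarrow> 'a) \<Rightarrow> 'a measure \<Rightarrow> 'a set set \<Rightarrow> bool" where
  "eventually_alike T \<mu> P \<longleftrightarrow> (\<forall>\<epsilon>>0. \<exists>L. \<forall>n\<ge>L. \<exists>A\<subseteq>join_words T P n.
     measure \<mu> (\<Union>w\<in>A. atom_of T w) > 1 - \<epsilon> \<and> (\<forall>u\<in>A. \<forall>w\<in>A. edit_distance u w < \<epsilon>))"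

text \<open>Pairwise closeness places all of \<open>A\<close> in one edit ball centred at any of its
  words; the weight \<open>t\<close> of the ball count is set to \<epsilon>. One term
  \<open>\<epsilon> * ln (card P)\<close> comes from the free letters of words in the ball, the
  other from the names outside \<open>A\<close>.\<close>

lemma join_partition_entropy_alike_le:
  fixes T :: "'a::topological_space \<Rightarrow> 'a"
  assumes \<mu>: "borel_prob \<mu>" and T: "continuous_on UNIV T" and P: "finite_borel_partition P"
    and \<epsilon>: "0 < \<epsilon>" "\<epsilon> < 1" and n: "n > 0" and A: "A \<subseteq> join_words T P n"
    and mA: "measure \<mu> (\<Union>w\<in>A. atom_of T w) > 1 - \<epsilon>"
    and close: "\<forall>u\<in>A. \<forall>w\<in>A. edit_distance u w < \<epsilon>"
  shows "partition_entropy \<mu> (join_partition T P n) / real n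
    \<le> 2 / real n + 2 * ln (1 + \<epsilon>) - 2 * \<epsilon> * ln \<epsilon> + 2 * \<epsilon> * ln (real (card P))"
proof -
  have finP: "finite P" and P0: "P \<noteq> {}" using P by (auto simp: finite_borel_partition_def partition_on_def)
  have "A \<noteq> {}"
  proof
    assume "A = {}"
    then show False using mA \<epsilon> by simp
  qed
  then obtain u where u: "u \<in> A" by blast
  define C where "C = ((1 + \<epsilon>) ^ n * \<epsilon> powr (- (\<epsilon> * real n)))\<^sup>2 * real (card P) powr (\<epsilon> * real n)"
  have P1: "1 \<le> real (card P)" using finP P0 by (simp add: Suc_le_eq card_gt_0_iff)
  have 1: "real (card A) \<le> C"
    unfolding C_def
    by (rule card_edit_ball_le[of P n u]) (use finP P0 n \<epsilon> u A close in \<open>auto simp: join_words_def\<close>)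
  have "finite A" by (rule finite_subset[OF A finite_join_words(1)[OF finP]])
  then have "1 \<le> real (card A)" using u by (auto simp: Suc_le_eq card_gt_0_iff)
  then have 2: "1 \<le> C" using 1 by linarith
  have lnC: "ln C = real n * (2 * ln (1 + \<epsilon>) - 2 * \<epsilon> * ln \<epsilon> + \<epsilon> * ln (real (card P)))"
    unfolding C_def using \<epsilon> P1
    by (simp add: ln_mult ln_realpow ln_powr algebra_simps)
  have "partition_entropy \<mu> (join_partition T P n) \<le> 2 + ln C + \<epsilon> * real n * ln (real (card P))"
    by (rule join_partition_entropy_le[OF \<mu> T P A mA 1 2])
  also have "\<dots> = (2 / real n + 2 * ln (1 + \<epsilon>) - 2 * \<epsilon> * ln \<epsilon> + 2 * \<epsilon> * ln (real (card P))) * real n"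
    using n unfolding lnC by (simp add: field_simps)
  finally show ?thesis using n by (subst pos_divide_le_eq) auto
qed

text \<open>Apply \<open>ln y \<le> y - 1\<close> at \<open>y = 1 / sqrt x\<close>. This makes the
  term \<open>- 2 * \<epsilon> * ln \<epsilon>\<close> of the entropy bound vanish with
  \<epsilon>.\<close>

lemma neg_mult_ln_le_sqrt:
  fixes x :: real
  assumes "0 < x"
  shows "- (x * ln x) \<le> 2 * sqrt x"
proof -
  have "ln (1 / sqrt x) \<le> 1 / sqrt x - 1" using assms by (intro ln_le_minus_one) simp
  moreover have "ln (1 / sqrt x) = - ln x / 2" using assms by (simp add: ln_div ln_sqrt)
  ultimately have "- ln x \<le> 2 * (1 / sqrt x)" by simp
  then have "x * (- ln x) \<le> x * (2 * (1 / sqrt x))" using assms by (intro mult_left_mono) auto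
  also have "\<dots> = 2 * (x / sqrt x)" by simp
  also have "x / sqrt x = sqrt x" using assms by (intro real_div_sqrt) simp
  finally show ?thesis by simp
qed

lemma ks_entropy_eq_0:
  fixes T :: "'a::topological_space \<Rightarrow> 'a"
  assumes \<mu>: "borel_prob \<mu>" and T: "continuous_on UNIV T"
    and alike: "\<And>P. finite_borel_partition P \<Longrightarrow> eventually_alike T \<mu> P"
  shows "ks_entropy T \<mu> = 0"
proof (rule antisym)
  show "ks_entropy T \<mu> \<le> 0"
    unfolding ks_entropy_def
  proof (rule SUP_least)
    fix P :: "'a set set" assume "P \<in> {P. finite_borel_partition P}"
    then have P: "finite_borel_partition P" by simp
    define c where "c = ln (real (card P))"
    \<comment> \<open>Collects the estimates \<open>2 / n < \<epsilon>\<close>,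
      \<open>2 * ln (1 + \<epsilon>) \<le> 2 * \<epsilon>\<close> and
      \<open>- 2 * \<epsilon> * ln \<epsilon> \<le> 4 * sqrt \<epsilon>\<close>.\<close>
    define g where "g = (\<lambda>\<epsilon>. 3 * \<epsilon> + 4 * sqrt \<epsilon> + 2 * \<epsilon> * c)"
    have le: "dynamical_entropy T \<mu> P \<le> ereal (g \<epsilon>)" if \<epsilon>: "0 < \<epsilon>" "\<epsilon> < 1" for \<epsilon>
      unfolding dynamical_entropy_def
    proof (rule Limsup_bounded)
      obtain L where L: "\<And>n. n \<ge> L \<Longrightarrow> \<exists>A\<subseteq>join_words T P n.
          measure \<mu> (\<Union>w\<in>A. atom_of T w) > 1 - \<epsilon> \<and> (\<forall>u\<in>A. \<forall>w\<in>A. edit_distance u w < \<epsilon>)"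
        using alike[OF P] \<epsilon> unfolding eventually_alike_def by blast
      have "\<forall>\<^sub>F n in sequentially. 2 / real n < \<epsilon>"
        by (rule order_tendstoD[OF lim_const_over_n]) (use \<epsilon> in auto)
      then show "\<forall>\<^sub>F n in sequentially. ereal (partition_entropy \<mu> (join_partition T P n) / real n) \<le> ereal (g \<epsilon>)"
        using eventually_ge_at_top[of L] eventually_gt_at_top[of 0]
      proof eventually_elim
        case (elim n)
        obtain A where A: "A \<subseteq> join_words T P n" "measure \<mu> (\<Union>w\<in>A. atom_of T w) > 1 - \<epsilon>"
          "\<forall>u\<in>A. \<forall>w\<in>A. edit_distance u w < \<epsilon>"
          using L[OF elim(2)] by blast
        have "partition_entropy \<mu> (join_partition T P n) / real n
            \<le> 2 / real n + 2 * ln (1 + \<epsilon>) - 2 * \<epsilon> * ln \<epsilon> + 2 * \<epsilon> * c"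
          unfolding c_def by (rule join_partition_entropy_alike_le[OF \<mu> T P \<epsilon> elim(3) A])
        moreover have "ln (1 + \<epsilon>) \<le> \<epsilon>" using \<epsilon> by (intro ln_add_one_self_le_self) simp
        ultimately have "partition_entropy \<mu> (join_partition T P n) / real n \<le> g \<epsilon>"
          using elim(1) neg_mult_ln_le_sqrt[OF \<epsilon>(1)] unfolding g_def by simp
        then show ?case by simp
      qed
    qed
    have "(g \<longlongrightarrow> g 0) (at_right 0)" unfolding g_def by (intro tendsto_intros)
    then have g0: "(g \<longlongrightarrow> 0) (at_right 0)" by (simp add: g_def)
    show "dynamical_entropy T \<mu> P \<le> 0"
    proof (rule ccontr)
      assume "\<not> dynamical_entropy T \<mu> P \<le> 0"
      then obtain r where r: "0 < ereal r" "ereal r < dynamical_entropy T \<mu> P"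
        using ereal_dense2[of 0 "dynamical_entropy T \<mu> P"] by (auto simp: not_le)
      have "\<forall>\<^sub>F \<epsilon> in at_right 0. g \<epsilon> < r" using g0 r(1) by (intro order_tendstoD) auto
      moreover have "\<forall>\<^sub>F \<epsilon> in at_right (0::real). \<epsilon> \<in> {0<..<1}" by (rule eventually_at_right_real) simp
      ultimately have "\<forall>\<^sub>F \<epsilon> in at_right (0::real). False"
      proof eventually_elim
        case (elim \<epsilon>)
        then have "dynamical_entropy T \<mu> P \<le> ereal (g \<epsilon>)" using le by simp
        then have "ereal r < ereal (g \<epsilon>)" using r(2) by (rule less_le_trans[rotated])
        then show ?case using elim by simp
      qed
      then show False by simp
    qed
  qed
  \<comment> \<open>One partition with nonnegative entropy bounds the supremum from below; the
    trivial one will do.\<close>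
  have UNIV: "finite_borel_partition {UNIV :: 'a set}"
    by (auto simp: finite_borel_partition_def partition_on_def disjoint_def)
  have "0 \<le> dynamical_entropy T \<mu> {UNIV}"
    unfolding dynamical_entropy_def
    by (rule le_Limsup) (use partition_entropy_nonneg[OF borel_probD(1)[OF \<mu>]] in \<open>auto intro!: always_eventually\<close>)
  also have "\<dots> \<le> ks_entropy T \<mu>" unfolding ks_entropy_def by (rule SUP_upper) (use UNIV in simp)
  finally show "0 \<le> ks_entropy T \<mu>" .
qed

text \<open>If \<open>B\<close> is invariant, the words of the partition into \<open>B\<close> and its complement are constant, so two
  distinct ones have edit distance 1.\<close>

lemma ergodic_measure_if_alike:
  fixes T :: "'a::topological_space \<Rightarrow> 'a"
  assumes \<mu>: "invariant_measure T \<mu>"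
    and alike: "\<And>P. finite_borel_partition P \<Longrightarrow> eventually_alike T \<mu> P"
  shows "ergodic_measure T \<mu>"
  unfolding ergodic_measure_def
proof (intro conjI ballI impI \<mu>)
  fix B assume B: "B \<in> sets borel" "T -` B = B"
  have bp: "borel_prob \<mu>" using \<mu> by (simp add: invariant_measure_def)
  interpret prob_space \<mu> using borel_probD[OF bp] by simp
  show "measure \<mu> B = 0 \<or> measure \<mu> B = 1"
  proof (rule ccontr)
    assume neg: "\<not> (measure \<mu> B = 0 \<or> measure \<mu> B = 1)"
    then have neg0: "0 < measure \<mu> B" "measure \<mu> B < 1" by (auto simp: less_le)
    have ne: "B \<noteq> {}" "B \<noteq> UNIV" using neg prob_space borel_probD(3)[OF bp] by auto
    define P where "P = {B, - B}"
    have part: "partition_on UNIV P" using ne by (auto simp: P_def partition_on_def disjoint_def)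
    have P: "finite_borel_partition P" using part B by (auto simp: finite_borel_partition_def P_def)
    have inv: "(T ^^ j) x \<in> B \<longleftrightarrow> x \<in> B" for j x
      by (induction j) (use B(2) in auto)
    have cellB: "cell P x = (if x \<in> B then B else - B)" for x
      by (rule cell_eq[OF part]) (auto simp: P_def)
    \<comment> \<open>With \<epsilon> at most either mass, atoms of total measure above
      \<open>1 - \<epsilon>\<close> must meet both \<open>B\<close> and its complement.\<close>
    define \<epsilon> where "\<epsilon> = min (measure \<mu> B) (1 - measure \<mu> B)"
    have \<epsilon>: "0 < \<epsilon>" "\<epsilon> \<le> 1" using neg0 by (auto simp: \<epsilon>_def)
    obtain L where L: "\<And>n. n \<ge> L \<Longrightarrow> \<exists>A\<subseteq>join_words T P n.
        measure \<mu> (\<Union>w\<in>A. atom_of T w) > 1 - \<epsilon> \<and> (\<forall>u\<in>A. \<forall>w\<in>A. edit_distance u w < \<epsilon>)"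
      using alike[OF P] \<epsilon> unfolding eventually_alike_def by blast
    define n where "n = Suc L"
    obtain A where A: "A \<subseteq> join_words T P n" "measure \<mu> (\<Union>w\<in>A. atom_of T w) > 1 - \<epsilon>"
      "\<forall>u\<in>A. \<forall>w\<in>A. edit_distance u w < \<epsilon>"
      using L[of n] by (auto simp: n_def)
    let ?U = "\<Union>w\<in>A. atom_of T w"
    have "?U \<inter> B \<noteq> {}"
    proof
      assume "?U \<inter> B = {}"
      then have "measure \<mu> ?U \<le> measure \<mu> (- B)"
        using B borel_probD[OF bp] by (intro finite_measure_mono) auto
      also have "\<dots> = 1 - measure \<mu> B"
        using prob_compl[of B] B borel_probD[OF bp] by (simp add: Compl_eq_Diff_UNIV)
      finally show False using A(2) by (simp add: \<epsilon>_def)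
    qed
    then obtain x u where x: "x \<in> B" "u \<in> A" "x \<in> atom_of T u" by auto
    have "?U \<inter> - B \<noteq> {}"
    proof
      assume "?U \<inter> - B = {}"
      then have "measure \<mu> ?U \<le> measure \<mu> B"
        using B borel_probD[OF bp] by (intro finite_measure_mono) auto
      then show False using A(2) by (simp add: \<epsilon>_def)
    qed
    then obtain y w where y: "y \<notin> B" "w \<in> A" "y \<in> atom_of T w" by auto
    have uw: "u = word_at T P n x" "w = word_at T P n y"
      using atom_of_eq_word_at[OF part] A(1) x y by blast+
    have "edit_distance u w < \<epsilon>" using A(3) x y by blast
    moreover have "max_common_subword u w = 0"
    proof (rule ccontr)
      assume pos: "max_common_subword u w \<noteq> 0"
      obtain i j where "\<And>s. s < max_common_subword u w \<Longrightarrow> i s < length u \<and> j s < length w \<and> u ! i s = w ! j s"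
        using max_common_subwordE[of u w] by metis
      from this[of 0] pos have "i 0 < n" "j 0 < n" "u ! i 0 = w ! j 0" by (auto simp: uw)
      then have "B = - B" using x y by (simp add: uw cellB inv)
      then show False using x by blast
    qed
    ultimately show False using \<epsilon> by (simp add: edit_distance_def)
  qed
qed

section \<open>Approximation by periodic sequences\<close>

text \<open>The cells are the sets of points lying in the same balls of a finite cover.\<close>

lemma small_diameter_partition:
  assumes "compact (UNIV :: 'a::metric_space set)" "e > 0"
  obtains P :: "'a::metric_space set set" where "finite_borel_partition P"
    "\<And>p x y. p \<in> P \<Longrightarrow> x \<in> p \<Longrightarrow> y \<in> p \<Longrightarrow> dist x y < e"
proof -
  obtain C :: "'a set" where C: "finite C" "UNIV \<subseteq> (\<Union>c\<in>C. ball c (e / 2))"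
    using assms unfolding compact_eq_totally_bounded by (metis half_gt_zero)
  define f where "f = (\<lambda>x. {c\<in>C. x \<in> ball c (e / 2)})"
  define P where "P = range (\<lambda>x. f -` {f x})"
  have eq: "f -` {f x} = (\<Inter>c\<in>C. {y. y \<in> ball c (e / 2) \<longleftrightarrow> x \<in> ball c (e / 2)})" for x
    unfolding f_def by blast
  have "C \<noteq> {}" using C by auto
  have ball: "{y. y \<in> ball c (e / 2) \<longleftrightarrow> b} \<in> sets borel" for c :: 'a and b
  proof (cases b)
    case False
    then have "{y. y \<in> ball c (e / 2) \<longleftrightarrow> b} = - ball c (e / 2)" by blast
    then show ?thesis by (simp only: borel_open open_ball borel_comp)
  next
    case True
    then have "{y. y \<in> ball c (e / 2) \<longleftrightarrow> b} = ball c (e / 2)" by blast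
    then show ?thesis by (simp only: borel_open open_ball)
  qed
  have borel: "f -` {f x} \<in> sets borel" for x
    unfolding eq using C(1) \<open>C \<noteq> {}\<close> ball by (intro sets.finite_INT) auto
  have "P \<subseteq> (\<lambda>D. f -` {D}) ` Pow C" by (auto simp: P_def f_def)
  then have "finite P" using C(1) by (meson finite_Pow_iff finite_imageI finite_subset)
  moreover have "partition_on UNIV P" by (auto simp: P_def partition_on_def disjoint_def)
  ultimately have "finite_borel_partition P" using borel by (auto simp: finite_borel_partition_def P_def)
  moreover have "dist x y < e" if "p \<in> P" "x \<in> p" "y \<in> p" for p x y
  proof -
    obtain c where c: "c \<in> C" "x \<in> ball c (e / 2)" using C(2) by blast
    have "f x = f y" using that by (auto simp: P_def)
    then have "y \<in> ball c (e / 2)" using c by (auto simp: f_def)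
    then show ?thesis using c(2) unfolding mem_ball by (rule dist_triangle_half_r[rotated])
  qed
  ultimately show ?thesis using that by blast
qed

text \<open>In this form the points admitting a match are a finite union of finite intersections, so
  openness or closedness of the single conditions \<open>E\<close> carries over.\<close>

lemma order_match_iff_family:
  "order_match E n k \<longleftrightarrow> (\<exists>S\<in>{S. S \<subseteq> {..<n} \<times> {..<n} \<and> chain_rel S \<and> k \<le> real (card S)}. \<forall>s\<in>S. E (fst s) (snd s))"
  by (auto simp: order_match_def case_prod_beta)

lemma finite_order_match_family:
  "finite {S. S \<subseteq> {..<n::nat} \<times> {..<n::nat} \<and> chain_rel S \<and> k \<le> real (card S)}"
  by (rule finite_subset[of _ "Pow ({..<n} \<times> {..<n})"]) auto

lemma open_order_match:
  fixes T :: "'a::metric_space \<Rightarrow> 'a"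
  assumes "continuous_on UNIV T"
  shows "open {x. order_match (\<lambda>i j. dist ((T ^^ i) x) (y j) < e) n k}"
  unfolding order_match_iff_family Collect_bex_eq Collect_ball_eq
  by (intro open_UN ballI open_INT open_Collect_less continuous_intros
      continuous_on_subset[OF continuous_on_funpow[OF assms]])
    (auto intro: finite_subset[of _ "{..<n} \<times> {..<n}"])

lemma closed_order_match:
  fixes T :: "'a::metric_space \<Rightarrow> 'a"
  assumes "continuous_on UNIV T"
  shows "closed {x. order_match (\<lambda>i j. dist ((T ^^ i) x) (y j) \<le> e) n k}"
  unfolding order_match_iff_family Collect_bex_eq Collect_ball_eq
  by (intro closed_UN ballI closed_INT closed_Collect_le continuous_intros
      continuous_on_subset[OF continuous_on_funpow[OF assms]] finite_order_match_family) auto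

text \<open>\<open>U\<close> is open because generic orbits visit an open set at least as often as
  its measure predicts. Of \<open>y\<close> only the first \<open>n\<close> values matter; they
  become one period of a sequence later.\<close>

definition periodically_approximable :: "('a::metric_space \<Rightarrow> 'a) \<Rightarrow> 'a measure \<Rightarrow> bool" where
  "periodically_approximable T \<nu> \<longleftrightarrow> (\<forall>e. 0 < e \<longrightarrow> e < 1 \<longrightarrow> (\<exists>n>0. \<exists>U y. open U \<and> 1 - e < measure \<nu> U \<and>
     (\<forall>x\<in>U. order_match (\<lambda>i j. dist ((T ^^ i) x) (y j) < e) n ((1 - e) * real n))))"

text \<open>When points of a common cell are closer than \<open>e\<close>, equal letters imply close
  points, so the orbit of one point in a good atom serves as the word for all good atoms.\<close>

lemma loosely_kronecker_approximable:
  fixes T :: "'a::metric_space \<Rightarrow> 'a"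
  assumes X: "compact (UNIV :: 'a set)" and T: "continuous_on UNIV T" and lk: "loosely_kronecker T \<nu>"
  shows "periodically_approximable T \<nu>"
  unfolding periodically_approximable_def
proof (intro allI impI)
  fix e :: real assume e: "0 < e" "e < 1"
  have \<nu>: "borel_prob \<nu>" using lk by (simp add: loosely_kronecker_def ergodic_measure_def invariant_measure_def)
  interpret prob_space \<nu> using borel_probD[OF \<nu>] by simp
  obtain P :: "'a set set" where P: "finite_borel_partition P"
    and diam: "\<And>p x y. p \<in> P \<Longrightarrow> x \<in> p \<Longrightarrow> y \<in> p \<Longrightarrow> dist x y < e"
    using small_diameter_partition[OF X e(1)] by blast
  obtain n A where n: "n > 0" and A: "A \<subseteq> join_words T P n"
    "measure \<nu> (\<Union>w\<in>A. atom_of T w) > 1 - e" "\<forall>u\<in>A. \<forall>w\<in>A. edit_distance u w < e"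
    using lk P e unfolding loosely_kronecker_def by blast
  have "A \<noteq> {}" using A(2) e by auto
  then obtain u q where u: "u \<in> A" "q \<in> atom_of T u" using A(1) by (fastforce simp: join_words_def)
  \<comment> \<open>The union of the good atoms need not be open, so it is enlarged to all points
    matching the orbit of \<open>q\<close>.\<close>
  define U where "U = {x. order_match (\<lambda>i j. dist ((T ^^ i) x) ((T ^^ j) q) < e) n ((1 - e) * real n)}"
  have "open U" unfolding U_def by (rule open_order_match[OF T])
  have len: "length w = n" "set w \<subseteq> P" if "w \<in> A" for w using A(1) that by (auto simp: join_words_def)
  have "(\<Union>w\<in>A. atom_of T w) \<subseteq> U"
  proof
    fix x assume "x \<in> (\<Union>w\<in>A. atom_of T w)"
    then obtain w where w: "w \<in> A" "x \<in> atom_of T w" by auto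
    have "order_match (\<lambda>i j. w ! i = u ! j) n ((1 - e) * real n)"
      by (rule order_match_edit_distance) (use A(3) u w len n in auto)
    then have "order_match (\<lambda>i j. dist ((T ^^ i) x) ((T ^^ j) q) < e) n ((1 - e) * real n)"
    proof (rule order_match_mono)
      fix i j assume ij: "i < n" "j < n" "w ! i = u ! j"
      have "w ! i \<in> P" using len[OF w(1)] ij(1) nth_mem[of i w] by auto
      moreover have "(T ^^ i) x \<in> w ! i" using w(2) ij(1) len[OF w(1)] by (simp add: atom_of_def)
      moreover have "(T ^^ j) q \<in> w ! i" using u ij len[OF u(1)] by (simp add: atom_of_def)
      ultimately show "dist ((T ^^ i) x) ((T ^^ j) q) < e" by (rule diam)
    qed simp
    then show "x \<in> U" by (simp add: U_def)
  qed
  then have "measure \<nu> (\<Union>w\<in>A. atom_of T w) \<le> measure \<nu> U"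
    using \<open>open U\<close> borel_probD[OF \<nu>] by (intro finite_measure_mono) auto
  then have "1 - e < measure \<nu> U" using A(2) by simp
  then show "\<exists>n>0. \<exists>U y. open U \<and> 1 - e < measure \<nu> U \<and>
     (\<forall>x\<in>U. order_match (\<lambda>i j. dist ((T ^^ i) x) (y j) < e) n ((1 - e) * real n))"
    using n \<open>open U\<close> by (intro exI[of _ n] conjI exI[of _ U] exI[of _ "\<lambda>j. (T ^^ j) q"]) (auto simp: U_def)
qed

text \<open>The points of a periodic orbit see one periodic sequence in different phases, and a
  change of phase costs at most the period \<open>p\<close>; a length \<open>n\<close> with
  \<open>p < e * n\<close> absorbs it.\<close>

lemma periodic_measure_approximable:
  fixes T :: "'a::metric_space \<Rightarrow> 'a"
  assumes T: "continuous_on UNIV T" and per: "periodic_measure T \<nu>"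
  shows "periodically_approximable T \<nu>"
  unfolding periodically_approximable_def
proof (intro allI impI)
  fix e :: real assume e: "0 < e" "e < 1"
  obtain q where q: "periodic_point T q"
    and \<nu>: "\<nu> = distr (uniform_count_measure (range (trajectory T q))) borel (\<lambda>y. y)"
    using per by (auto simp: periodic_measure_def)
  obtain p where p: "p > 0" "(T ^^ p) q = q" using q by (auto simp: periodic_point_def)
  define y where "y = (\<lambda>j. (T ^^ j) q)"
  have yper: "y (j + p) = y j" for j using p(2) by (simp add: y_def funpow_add)
  have fin: "finite (range (trajectory T q))"
  proof (rule finite_subset)
    show "range (trajectory T q) \<subseteq> y ` {..<p}"
    proof
      fix x assume "x \<in> range (trajectory T q)"
      then obtain m where "x = (T ^^ m) q" by (auto simp: trajectory_def)
      then have "x = y (m mod p)" using funpow_mod_eq[OF p(2), of m] by (simp add: y_def)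
      then show "x \<in> y ` {..<p}" using p(1) by simp
    qed
  qed simp
  obtain n :: nat where n: "real p / e < real n" using reals_Archimedean2 by blast
  have pn: "real p < e * real n" using n e by (simp add: field_simps)
  then have "n > 0" using p(1) by (cases n) auto
  define U where "U = {x. order_match (\<lambda>i j. dist ((T ^^ i) x) (y j) < e) n ((1 - e) * real n)}"
  have "open U" unfolding U_def by (rule open_order_match[OF T])
  have sub: "range (trajectory T q) \<subseteq> U"
  proof
    fix x assume "x \<in> range (trajectory T q)"
    then obtain m where x: "x = (T ^^ m) q" by (auto simp: trajectory_def)
    have eq: "(T ^^ i) x = y (m + i)" for i unfolding x y_def by (metis add.commute comp_apply funpow_add)
    have "order_match (\<lambda>i j. dist ((T ^^ i) x) (y j) < e) n (real n - real p)"
      by (rule order_match_periodic_origin[where b = m, OF order_match_refl \<open>p > 0\<close>]) (use e in \<open>auto simp: eq yper\<close>)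
    then have "order_match (\<lambda>i j. dist ((T ^^ i) x) (y j) < e) n ((1 - e) * real n)"
      by (rule order_match_mono) (use pn in \<open>auto simp: algebra_simps\<close>)
    then show "x \<in> U" by (simp add: U_def)
  qed
  have meas: "(\<lambda>y. y) \<in> measurable (uniform_count_measure (range (trajectory T q))) borel"
    by (simp add: measurable_def space_uniform_count_measure sets_uniform_count_measure)
  have "measure \<nu> U = measure (uniform_count_measure (range (trajectory T q))) (range (trajectory T q))"
    unfolding \<nu> using \<open>open U\<close> sub
    by (subst measure_distr[OF meas]) (auto simp: space_uniform_count_measure Int_absorb1)
  also have "\<dots> = 1" using fin by (simp add: measure_uniform_count_measure)
  finally have "1 - e < measure \<nu> U" using e by simp
  then show "\<exists>n>0. \<exists>U y. open U \<and> 1 - e < measure \<nu> U \<and>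
     (\<forall>x\<in>U. order_match (\<lambda>i j. dist ((T ^^ i) x) (y j) < e) n ((1 - e) * real n))"
    using \<open>n > 0\<close> \<open>open U\<close> by (intro exI[of _ n] conjI exI[of _ U] exI[of _ y]) (auto simp: U_def)
qed

text \<open>The approximating word of length \<open>n\<close> is repeated periodically. The loss
  \<open>3 * e\<close> adds up the times outside \<open>U\<close>, the mismatches inside blocks and
  the unfinished last block.\<close>

lemma generic_point_near_periodic:
  fixes T :: "'a::metric_space \<Rightarrow> 'a"
  assumes approx: "periodically_approximable T \<nu>" and gen: "generic_point T x \<nu>" and e: "0 < e" "e < 1"
  obtains y :: "nat \<Rightarrow> 'a" and p where "p > 0" "\<forall>j. y (j + p) = y j"
    "\<forall>\<^sub>F N in sequentially. order_match (\<lambda>i j. dist (trajectory T x i) (y j) < e) N ((1 - 3 * e) * real N)"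
proof -
  obtain n U y0 where n: "n > 0" and U: "open U" "1 - e < measure \<nu> U"
    and m: "\<forall>x\<in>U. order_match (\<lambda>i j. dist ((T ^^ i) x) (y0 j) < e) n ((1 - e) * real n)"
    using approx[unfolded periodically_approximable_def, rule_format, OF e] by (elim exE conjE)
  define y where "y = (\<lambda>j. y0 (j mod n))"
  have yper: "y (j + n) = y j" for j by (simp add: y_def)
  have ev: "\<forall>\<^sub>F N in sequentially. real (card {i. i < N \<and> trajectory T x i \<notin> U}) < (1 - (1 - e)) * real N"
    using gen unfolding generic_point_def by (rule generic_seq_open[OF _ U])
  obtain N0 :: nat where N0: "real n / e < real N0" using reals_Archimedean2 by blast
  have "\<forall>\<^sub>F N in sequentially. order_match (\<lambda>i j. dist (trajectory T x i) (y j) < e) N ((1 - 3 * e) * real N)"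
    using ev eventually_ge_at_top[of N0]
  proof eventually_elim
    case (elim N)
    have "real n / e < real N" using elim(2) N0 by linarith
    then have nN: "real n < e * real N" using e by (simp add: field_simps)
    have "order_match (\<lambda>a b. dist (trajectory T x (a + 0)) (y b) < e) N
      (real N - real (card {j\<in>{0..<0 + N}. \<not> trajectory T x j \<in> U}) - e * real N - real n)"
    proof (rule order_match_blocks[OF n])
      fix i assume i: "trajectory T x i \<in> U"
      show "order_match (\<lambda>a b. dist (trajectory T x (a + i)) (y b) < e) n ((1 - e) * real n)"
        by (rule order_match_mono[OF m[rule_format, OF i]]) (simp_all add: y_def trajectory_def funpow_add)
    qed (use e yper in auto)
    moreover have "{j\<in>{0..<0 + N}. \<not> trajectory T x j \<in> U} = {i. i < N \<and> trajectory T x i \<notin> U}" by auto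
    ultimately show ?case
      by (elim order_match_mono) (use elim(1) nN in \<open>auto simp: algebra_simps\<close>)
  qed
  with that[of n y] n yper show ?thesis by simp
qed

lemma fk_lessD:
  assumes "fk x z < e"
  obtains \<delta> where "0 < \<delta>" "\<delta> < e"
    "\<forall>\<^sub>F N in sequentially. order_match (\<lambda>i j. dist (x i) (z j) < \<delta>) N ((1 - \<delta>) * real N)"
proof -
  let ?D = "{\<delta>. \<delta> > 0 \<and> fbar \<delta> x z < ereal \<delta>}"
  \<comment> \<open>Since \<open>fbar_n\<close> never exceeds 1, the number 2 is admissible; the set
    under the infimum is nonempty, so an admissible \<delta> below \<open>e\<close> can be
    extracted.\<close>
  have "fbar_n n 2 x z \<le> 1" for n by (simp add: fbar_n_def)
  then have "fbar 2 x z \<le> 1" unfolding fbar_def by (intro Limsup_bounded) simp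
  also have "(1::ereal) < ereal 2" by simp
  finally have "2 \<in> ?D" by simp
  then have "?D \<noteq> {}" by blast
  from cInf_lessD[OF this assms[unfolded fk_def]]
  obtain \<delta> where \<delta>: "\<delta> > 0" "fbar \<delta> x z < ereal \<delta>" "\<delta> < e" by auto
  have "\<forall>\<^sub>F N in sequentially. ereal (fbar_n N \<delta> x z) < ereal \<delta>"
    using \<delta>(2) unfolding fbar_def by (rule Limsup_lessD)
  then have "\<forall>\<^sub>F N in sequentially. order_match (\<lambda>i j. dist (x i) (z j) < \<delta>) N ((1 - \<delta>) * real N)"
    using eventually_gt_at_top[of 0]
    by eventually_elim (auto intro: order_match_fbar_n)
  with that \<delta> show ?thesis by blast
qed

lemma fk_limit_near_periodic:
  fixes T :: "'a::metric_space \<Rightarrow> 'a"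
  assumes approx: "\<And>n. periodically_approximable T (M n)" and gen: "\<And>n. generic_point T (X n) (M n)"
    and lim: "(\<lambda>n. fk z (trajectory T (X n))) \<longlonglongrightarrow> 0" and e: "0 < e" "e < 1"
  obtains y :: "nat \<Rightarrow> 'a" and p where "p > 0" "\<forall>j. y (j + p) = y j"
    "\<forall>\<^sub>F N in sequentially. order_match (\<lambda>i j. dist (z i) (y j) < e) N ((1 - e) * real N)"
proof -
  \<comment> \<open>A quarter, because passing from the orbit of \<open>X k\<close> to a periodic
    sequence at accuracy \<open>e / 4\<close> loses the other three quarters.\<close>
  have "\<forall>\<^sub>F n in sequentially. fk z (trajectory T (X n)) < e / 4" using lim e by (intro order_tendstoD) auto
  then obtain k where "fk z (trajectory T (X k)) < e / 4" by (auto simp: eventually_sequentially)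
  then obtain \<delta> where \<delta>: "0 < \<delta>" "\<delta> < e / 4"
    "\<forall>\<^sub>F N in sequentially. order_match (\<lambda>i j. dist (z i) (trajectory T (X k) j) < \<delta>) N ((1 - \<delta>) * real N)"
    by (rule fk_lessD)
  have e4: "0 < e / 4" "e / 4 < 1" using e by auto
  obtain y p where y: "p > 0" "\<forall>j. y (j + p) = y j"
    "\<forall>\<^sub>F N in sequentially. order_match (\<lambda>i j. dist (trajectory T (X k) i) (y j) < e / 4) N ((1 - 3 * (e / 4)) * real N)"
    by (rule generic_point_near_periodic[OF approx gen e4])
  have "\<forall>\<^sub>F N in sequentially. order_match (\<lambda>i j. dist (z i) (y j) < e) N ((1 - e) * real N)"
    using \<delta>(3) y(3)
  proof eventually_elim
    case (elim N)
    have "order_match (\<lambda>i j. dist (z i) (y j) < e) N ((1 - \<delta>) * real N + (1 - 3 * (e / 4)) * real N - real N)"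
    proof (rule order_match_compose[OF elim])
      fix i j l assume "dist (z i) (trajectory T (X k) j) < \<delta>" "dist (trajectory T (X k) j) (y l) < e / 4"
      then show "dist (z i) (y l) < e"
        using dist_triangle[of "z i" "y l" "trajectory T (X k) j"] \<delta> e by linarith
    qed
    moreover have "\<delta> * real N \<le> e / 4 * real N" using \<delta> by (intro mult_right_mono) auto
    ultimately show ?case by (elim order_match_mono) (auto simp: algebra_simps)
  qed
  with that[of p y] y show ?thesis by simp
qed

text \<open>A window is a true orbit segment unless one of its transitions is a defect. A defect
  spoils at most \<open>L\<close> windows, so a density of defects below \<open>e / L\<close>
  suffices.\<close>

lemma quasi_orbit_windows:
  assumes z: "quasi_orbit T z" and "0 < e" "L > 0"
  shows "\<forall>\<^sub>F N in sequentially. real (card {i. i + L \<le> N \<and> \<not> (\<forall>a<L. z (i + a) = (T ^^ a) (z i))}) \<le> e * real N"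
proof -
  define B where "B = {n. z (Suc n) \<noteq> T (z n)}"
  have "limsup (\<lambda>n. ereal (real (card (B \<inter> {..<n})) / real n)) < ereal (e / real L)"
    using z \<open>0 < e\<close> \<open>L > 0\<close> by (simp add: quasi_orbit_def upper_density_def B_def)
  then have "\<forall>\<^sub>F n in sequentially. ereal (real (card (B \<inter> {..<n})) / real n) < ereal (e / real L)"
    by (rule Limsup_lessD)
  then show ?thesis using eventually_gt_at_top[of 0]
  proof eventually_elim
    case (elim N)
    let ?W = "{i. i + L \<le> N \<and> \<not> (\<forall>a<L. z (i + a) = (T ^^ a) (z i))}"
    have "?W \<subseteq> (\<Union>a<L. (\<lambda>b. b - a) ` (B \<inter> {..<N}))"
    proof
      fix i assume i: "i \<in> ?W"
      have "\<exists>a<L. i + a \<in> B"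
      proof (rule ccontr)
        assume no: "\<not> (\<exists>a<L. i + a \<in> B)"
        have "a < L \<Longrightarrow> z (i + a) = (T ^^ a) (z i)" for a
        proof (induction a)
          case (Suc a)
          then show ?case using no by (auto simp: B_def dest: Suc_lessD)
        qed simp
        then show False using i by blast
      qed
      then obtain a where a: "a < L" "i + a \<in> B" by blast
      then have "i + a \<in> B \<inter> {..<N}" using i by auto
      then have "i \<in> (\<lambda>b. b - a) ` (B \<inter> {..<N})" by (rule rev_image_eqI) simp
      then show "i \<in> (\<Union>a<L. (\<lambda>b. b - a) ` (B \<inter> {..<N}))" using a by blast
    qed
    then have "card ?W \<le> card (\<Union>a<L. (\<lambda>b. b - a) ` (B \<inter> {..<N}))" by (intro card_mono) auto
    also have "\<dots> \<le> (\<Sum>a<L. card ((\<lambda>b. b - a) ` (B \<inter> {..<N})))" by (rule card_UN_le) simp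
    also have "\<dots> \<le> (\<Sum>a<L. card (B \<inter> {..<N}))" by (intro sum_mono card_image_le) simp
    finally have "real (card ?W) \<le> real L * real (card (B \<inter> {..<N}))"
      by (simp flip: of_nat_mult)
    also have "\<dots> \<le> e * real N" using elim \<open>L > 0\<close> by (simp add: field_simps)
    finally show ?case .
  qed
qed

text \<open>Visits of \<open>z\<close> to a closed set are bounded by its measure, so a closed set
  visited often is large. Removing the offsets of the matched windows lets one \<open>y\<close>
  serve all starts and all large \<open>L\<close>.\<close>

lemma measure_near_word:
  fixes T :: "'a::metric_space \<Rightarrow> 'a"
  assumes T: "continuous_on UNIV T" and z: "quasi_orbit T z" "generic_seq z \<mu>"
    and near: "\<And>e. 0 < e \<Longrightarrow> e < 1 \<Longrightarrow> \<exists>(y :: nat \<Rightarrow> 'a) p. p > 0 \<and> (\<forall>j. y (j + p) = y j) \<and>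
      (\<forall>\<^sub>F N in sequentially. order_match (\<lambda>i j. dist (z i) (y j) < e) N ((1 - e) * real N))"
    and e: "0 < e" "e < 1"
  obtains y :: "nat \<Rightarrow> 'a" and L0 where "\<forall>L\<ge>L0.
    1 - e \<le> measure \<mu> {x. order_match (\<lambda>i j. dist ((T ^^ i) x) (y j) \<le> e) L ((1 - e) * real L)}"
proof -
  \<comment> \<open>Counting windows with tolerance \<open>e / 2\<close> gives
    \<open>e / 2 * card bad \<le> 2 * \<eta> * N\<close>, which has to yield at most
    \<open>e / 4 * N\<close> bad windows.\<close>
  define \<eta> where "\<eta> = e\<^sup>2 / 16"
  have "0 < e * e" "e * e \<le> 1 * e" using e by (auto intro: mult_right_mono)
  then have \<eta>: "0 < \<eta>" "\<eta> < 1" "\<eta> \<le> e" using e unfolding \<eta>_def power2_eq_square by linarith+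
  obtain y p where p: "p > 0" and yper: "\<forall>j. y (j + p) = y j"
    and ev: "\<forall>\<^sub>F N in sequentially. order_match (\<lambda>i j. dist (z i) (y j) < \<eta>) N ((1 - \<eta>) * real N)"
    using near[OF \<eta>(1,2)] by blast
  \<comment> \<open>Ensures \<open>p \<le> e / 2 * L\<close>: the change of phase uses the half of
    \<open>e\<close> left over by the window tolerance.\<close>
  obtain L0 :: nat where L0: "2 * real p / e < real L0" using reals_Archimedean2 by blast
  have "1 - e \<le> measure \<mu> {x. order_match (\<lambda>i j. dist ((T ^^ i) x) (y j) \<le> e) L ((1 - e) * real L)}"
    if L: "L \<ge> L0" for L
  proof (rule ccontr)
    let ?F = "{x. order_match (\<lambda>i j. dist ((T ^^ i) x) (y j) \<le> e) L ((1 - e) * real L)}"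
    assume "\<not> 1 - e \<le> measure \<mu> ?F"
    then have small: "measure \<mu> ?F < 1 - e" by simp
    have "2 * real p / e < real L" using L L0 by linarith
    then have pL: "real p \<le> e / 2 * real L" using e by (simp add: field_simps)
    then have "L > 0" using p e by (cases L) auto
    have clF: "closed ?F" by (rule closed_order_match[OF T])
    obtain N1 :: nat where N1: "4 * real L / e < real N1" using reals_Archimedean2 by blast
    \<comment> \<open>More than \<open>e * N\<close> starts would miss \<open>?F\<close>, yet these
      are covered by three sets of at most \<open>e / 4 * N\<close> elements: unmatched windows,
      windows with a defect, and starts too close to \<open>N\<close> for a full window.\<close>
    have "e / 4 > 0" using e by simp
    have "\<forall>\<^sub>F N in sequentially. False"
      using generic_seq_closed[OF z(2) clF small] ev quasi_orbit_windows[OF z(1) \<open>e / 4 > 0\<close> \<open>L > 0\<close>]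
        eventually_ge_at_top[of N1] eventually_gt_at_top[of 0]
    proof eventually_elim
      case (elim N)
      let ?bad = "{i. i + L \<le> N \<and>
        \<not> (\<exists>b. order_match (\<lambda>a c. dist (z (i + a)) (y (b + c)) < \<eta>) L ((1 - e / 2) * real L))}"
      let ?W = "{i. i + L \<le> N \<and> \<not> (\<forall>a<L. z (i + a) = (T ^^ a) (z i))}"
      have W: "real (card ?W) \<le> e / 4 * real N" by (rule elim(3))
      have "e / 2 * real (card ?bad) \<le> 2 * \<eta> * real N"
        by (rule order_match_windows[OF elim(2) \<open>L > 0\<close>])
      then have bad: "real (card ?bad) \<le> e / 4 * real N"
        using e by (simp add: \<eta>_def power2_eq_square field_simps)
      have "4 * real L / e < real N" using elim(4) N1 by linarith
      then have LN: "real L \<le> e / 4 * real N" using e by (simp add: field_simps)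
      have good: "z i \<in> ?F" if i: "i + L \<le> N" "i \<notin> ?bad" "i \<notin> ?W" for i
      proof -
        obtain b where "order_match (\<lambda>a c. dist (z (i + a)) (y (b + c)) < \<eta>) L ((1 - e / 2) * real L)"
          using i by blast
        then have "order_match (\<lambda>a c. dist (z (i + a)) (y c) < \<eta>) L ((1 - e / 2) * real L - real p)"
          using p yper by (intro order_match_periodic_origin) auto
        then have "order_match (\<lambda>a c. dist ((T ^^ a) (z i)) (y c) \<le> e) L ((1 - e) * real L)"
          by (rule order_match_mono) (use i \<eta> pL in \<open>auto simp: algebra_simps\<close>)
        then show ?thesis by simp
      qed
      have "{..<N} \<subseteq> {i. i < N \<and> z i \<in> ?F} \<union> ?bad \<union> ?W \<union> {N - L..<N}"
      proof
        fix i assume "i \<in> {..<N}"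
        then show "i \<in> {i. i < N \<and> z i \<in> ?F} \<union> ?bad \<union> ?W \<union> {N - L..<N}"
          using good[of i] by (cases "i + L \<le> N") (blast, auto)
      qed
      moreover have fin: "finite {i. i < N \<and> z i \<in> ?F}" "finite ?bad" "finite ?W" "finite {N - L..<N}"
        by (auto intro: finite_subset[of _ "{..N}"])
      ultimately have "card {..<N} \<le> card ({i. i < N \<and> z i \<in> ?F} \<union> ?bad \<union> ?W \<union> {N - L..<N})"
        by (intro card_mono finite_UnI)
      also have "\<dots> \<le> card {i. i < N \<and> z i \<in> ?F} + card ?bad + card ?W + card {N - L..<N}"
        by (intro order_trans[OF card_Un_le] add_mono order_refl)
      finally have "real N \<le> real (card {i. i < N \<and> z i \<in> ?F}) + real (card ?bad) + real (card ?W) + real L"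
        by simp
      moreover have "real (card {i. i < N \<and> z i \<in> ?F}) < (1 - e) * real N" by (rule elim(1))
      ultimately have "real N < (1 - e) * real N + e / 4 * real N + e / 4 * real N + e / 4 * real N"
        using W bad LN by linarith
      then have "e * real N < 3 / 4 * (e * real N)" by (simp add: algebra_simps)
      then show False using e elim(5) by simp
    qed
    then show False by simp
  qed
  then have "\<forall>L\<ge>L0. 1 - e \<le> measure \<mu> {x. order_match (\<lambda>i j. dist ((T ^^ i) x) (y j) \<le> e) L ((1 - e) * real L)}"
    by blast
  then show ?thesis by (rule that)
qed

section \<open>Names for the limit measure\<close>

lemma separate_disjoint_closed:
  fixes S C :: "'a::metric_space set"
  assumes "compact S" "closed C" "S \<inter> C = {}"
  obtains d where "d > 0" "\<And>x y. x \<in> S \<Longrightarrow> y \<in> C \<Longrightarrow> d \<le> dist x y"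
proof (cases "S = {} \<or> C = {}")
  case True
  then show ?thesis using that[of 1] by auto
next
  case False
  have "continuous_on S (\<lambda>x. infdist x C)" by (intro continuous_intros)
  then obtain s where s: "s \<in> S" "\<forall>x\<in>S. infdist s C \<le> infdist x C"
    using continuous_attains_inf[OF assms(1), of "\<lambda>x. infdist x C"] False by blast
  have "0 < infdist s C" using s(1) assms False by (intro infdist_pos_not_in_closed) auto
  moreover have "infdist s C \<le> dist x y" if "x \<in> S" "y \<in> C" for x y
    using s(2) that infdist_le[of y C x] by force
  ultimately show ?thesis using that by blast
qed

text \<open>Nearby points may lie in different cells however close they are. Closed subsets filling
  the cells up to small measure are disjoint compact sets, hence a positive distance apart.\<close>

lemma partition_core:
  fixes P :: "'a::metric_space set set"
  assumes X: "compact (UNIV :: 'a set)" and \<mu>: "borel_prob \<mu>" and P: "finite_borel_partition P" and "e > 0"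
  obtains K d where "closed K" "measure \<mu> (- K) < e" "d > 0"
    "\<forall>x\<in>K. \<forall>y\<in>K. dist x y < d \<longrightarrow> cell P x = cell P y"
proof -
  interpret prob_space \<mu> using borel_probD[OF \<mu>] by simp
  have part: "partition_on UNIV P" and finP: "finite P" and PB: "P \<subseteq> sets borel"
    using P by (auto simp: finite_borel_partition_def)
  have "P \<noteq> {}" using part by (auto simp: partition_on_def)
  then have c: "real (card P) > 0" using finP by (simp add: card_gt_0_iff)
  have "\<exists>K. closed K \<and> K \<subseteq> p \<and> measure \<mu> (p - K) < e / real (card P)" if "p \<in> P" for p
    using closed_inner_regular[OF \<mu>, of p "e / real (card P)"] PB that \<open>e > 0\<close> c
    by (metis divide_pos_pos subsetD)
  then obtain k where k: "\<And>p. p \<in> P \<Longrightarrow> closed (k p)" "\<And>p. p \<in> P \<Longrightarrow> k p \<subseteq> p"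
    "\<And>p. p \<in> P \<Longrightarrow> measure \<mu> (p - k p) < e / real (card P)"
    by metis
  define K where "K = (\<Union>p\<in>P. k p)"
  have "closed K" unfolding K_def using finP k(1) by blast
  have disj: "p = q" if "p \<in> P" "q \<in> P" "x \<in> p" "x \<in> q" for p q x
    using cell_eq[OF part] that by metis
  have "- K \<subseteq> (\<Union>p\<in>P. p - k p)" using cell_in[OF part] by (fastforce simp: K_def)
  then have "measure \<mu> (- K) \<le> measure \<mu> (\<Union>p\<in>P. p - k p)"
    using finP PB k(1) borel_probD[OF \<mu>] by (intro finite_measure_mono) (auto intro!: sets.finite_UN)
  also have "\<dots> \<le> (\<Sum>p\<in>P. measure \<mu> (p - k p))"
    using finP PB k(1) borel_probD[OF \<mu>] by (intro finite_measure_subadditive_finite) auto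
  also have "\<dots> < (\<Sum>p\<in>P. e / real (card P))"
    using finP \<open>P \<noteq> {}\<close> k(3) by (rule sum_strict_mono)
  also have "\<dots> = e" using c by simp
  finally have mK: "measure \<mu> (- K) < e" .
  have "\<exists>d>0. \<forall>x\<in>k p. \<forall>y\<in>(\<Union>q\<in>P - {p}. k q). d \<le> dist x y" if p: "p \<in> P" for p
  proof (rule separate_disjoint_closed)
    show "compact (k p)" using compact_Int_closed[OF X k(1)[OF p]] by simp
    show "closed (\<Union>q\<in>P - {p}. k q)" using finP k(1) by blast
    show "k p \<inter> (\<Union>q\<in>P - {p}. k q) = {}" using disj k(2) p by blast
  qed blast
  then obtain d where d: "\<And>p. p \<in> P \<Longrightarrow> d p > 0"
    "\<And>p. p \<in> P \<Longrightarrow> \<forall>x\<in>k p. \<forall>y\<in>(\<Union>q\<in>P - {p}. k q). d p \<le> dist x y" by metis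
  define D where "D = Min (d ` P)"
  have "D > 0" unfolding D_def using finP \<open>P \<noteq> {}\<close> d(1) by simp
  moreover have "\<forall>x\<in>K. \<forall>y\<in>K. dist x y < D \<longrightarrow> cell P x = cell P y"
  proof (intro ballI impI)
    fix x y assume "x \<in> K" "y \<in> K" and lt: "dist x y < D"
    then obtain p q where pq: "p \<in> P" "x \<in> k p" "q \<in> P" "y \<in> k q" by (auto simp: K_def)
    have "D \<le> d p" unfolding D_def using finP pq(1) by simp
    then have "p = q" using d(2)[OF pq(1)] pq lt by fastforce
    then show "cell P x = cell P y" using cell_eq[OF part] pq k(2) by blast
  qed
  ultimately show ?thesis using that \<open>closed K\<close> mK by blast
qed

section \<open>Visit counts under an invariant measure\<close>

lemma invariant_measure_funpow:
  fixes T :: "'a::topological_space \<Rightarrow> 'a"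
  assumes \<mu>: "invariant_measure T \<mu>" and T: "continuous_on UNIV T" and B: "B \<in> sets borel"
  shows "measure \<mu> ((T ^^ j) -` B) = measure \<mu> B"
proof (induction j)
  case (Suc j)
  have bp: "borel_prob \<mu>" and inv: "distr \<mu> borel T = \<mu>" using \<mu> by (auto simp: invariant_measure_def)
  have Bj: "(T ^^ j) -` B \<in> sets borel"
    using measurable_sets[OF measurable_funpow_borel[OF T] B] by simp
  have "T \<in> measurable \<mu> borel"
    using borel_measurable_continuous_onI[OF T] borel_probD(2)[OF bp] by (simp cong: measurable_cong_sets)
  then have "measure (distr \<mu> borel T) ((T ^^ j) -` B) = measure \<mu> (T -` ((T ^^ j) -` B) \<inter> space \<mu>)"
    using Bj by (rule measure_distr)
  moreover have "T -` ((T ^^ j) -` B) = (T ^^ Suc j) -` B" by (auto simp: funpow_swap1)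
  ultimately show ?case using Suc inv borel_probD(3)[OF bp] by (simp del: funpow.simps)
qed simp

text \<open>Markov's inequality for the number of visits, whose integral is
  \<open>L * measure \<mu> B\<close> by invariance.\<close>

lemma measure_many_visits_le:
  fixes T :: "'a::topological_space \<Rightarrow> 'a"
  assumes \<mu>: "invariant_measure T \<mu>" and T: "continuous_on UNIV T" and B: "B \<in> sets borel"
    and "c > 0" "L > 0"
  shows "measure \<mu> {x. c * real L \<le> real (card {j. j < L \<and> (T ^^ j) x \<in> B})} \<le> measure \<mu> B / c"
    and "{x. c * real L \<le> real (card {j. j < L \<and> (T ^^ j) x \<in> B})} \<in> sets borel"
proof -
  have bp: "borel_prob \<mu>" using \<mu> by (simp add: invariant_measure_def)
  interpret prob_space \<mu> using borel_probD[OF bp] by simp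
  have sets: "sets \<mu> = sets borel" and space: "space \<mu> = UNIV" using borel_probD[OF bp] by auto
  define g where "g = (\<lambda>x. \<Sum>j<L. indicator ((T ^^ j) -` B) x :: real)"
  have Bj: "(T ^^ j) -` B \<in> sets \<mu>" for j
    using measurable_sets[OF measurable_funpow_borel[OF T] B] sets by simp
  have g: "real (card {j. j < L \<and> (T ^^ j) x \<in> B}) = g x" for x
    by (simp add: g_def indicator_def sum.If_cases Int_def lessThan_def)
  have int: "integrable \<mu> g" unfolding g_def using Bj by (intro Bochner_Integration.integrable_sum) (simp add: integrable_real_indicator emeasure_finite less_top[symmetric])
  have "integral\<^sup>L \<mu> g = (\<Sum>j<L. measure \<mu> ((T ^^ j) -` B))"
    unfolding g_def using Bj space by (subst Bochner_Integration.integral_sum) (simp_all add: emeasure_finite less_top[symmetric])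
  also have "\<dots> = real L * measure \<mu> B" using invariant_measure_funpow[OF \<mu> T B] by simp
  finally have ig: "integral\<^sup>L \<mu> g = real L * measure \<mu> B" .
  have "measure \<mu> {x\<in>space \<mu>. g x \<ge> c * real L} \<le> integral\<^sup>L \<mu> g / (c * real L)"
    by (rule integral_Markov_inequality_measure[where A = "{}"])
      (use int \<open>c > 0\<close> \<open>L > 0\<close> in \<open>auto simp: g_def sum_nonneg\<close>)
  then show "measure \<mu> {x. c * real L \<le> real (card {j. j < L \<and> (T ^^ j) x \<in> B})} \<le> measure \<mu> B / c"
    using \<open>L > 0\<close> unfolding g ig space by simp
  have "g \<in> borel_measurable \<mu>" using int by auto
  then have "{x\<in>space \<mu>. c * real L \<le> g x} \<in> sets \<mu>" by measurable
  then show "{x. c * real L \<le> real (card {j. j < L \<and> (T ^^ j) x \<in> B})} \<in> sets borel"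
    unfolding g sets space by simp
qed

text \<open>Two points matched with the same word are matched with each other within
  \<open>2 * e'\<close>, and at times when both orbits are in the core \<open>K\<close> such
  closeness forces equal letters.\<close>

lemma eventually_alike_if_near_words:
  fixes T :: "'a::metric_space \<Rightarrow> 'a"
  assumes X: "compact (UNIV :: 'a set)" and T: "continuous_on UNIV T" and \<mu>: "invariant_measure T \<mu>"
    and near: "\<And>e. 0 < e \<Longrightarrow> e < 1 \<Longrightarrow> \<exists>(y :: nat \<Rightarrow> 'a) L0. \<forall>L\<ge>L0.
      1 - e \<le> measure \<mu> {x. order_match (\<lambda>i j. dist ((T ^^ i) x) (y j) \<le> e) L ((1 - e) * real L)}"
    and P: "finite_borel_partition P"
  shows "eventually_alike T \<mu> P"
  unfolding eventually_alike_def
proof (intro allI impI)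
  fix \<epsilon> :: real assume "\<epsilon> > 0"
  have bp: "borel_prob \<mu>" using \<mu> by (simp add: invariant_measure_def)
  interpret prob_space \<mu> using borel_probD[OF bp] by simp
  have sets: "sets \<mu> = sets borel" and space: "space \<mu> = UNIV" using borel_probD[OF bp] by auto
  have part: "partition_on UNIV P" and finP: "finite P" and PB: "P \<subseteq> sets borel"
    using P by (auto simp: finite_borel_partition_def)
  \<comment> \<open>Names will differ by at most \<open>4 * e\<close>: two matches with
    \<open>y\<close> and two removals of times outside \<open>K\<close> lose at most
    \<open>e\<close> each. The good set misses at most \<open>2 * e\<close> of the measure.\<close>
  define e where "e = min (\<epsilon> / 8) (1 / 2)"
  have e: "0 < e" "e < 1" "8 * e \<le> \<epsilon>" using \<open>\<epsilon> > 0\<close> by (auto simp: e_def)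
  have ee: "0 < e * e" using e by simp
  \<comment> \<open>The square prepares Markov's inequality: points spending at least a proportion
    \<open>e\<close> of their time outside \<open>K\<close> then have measure at most
    \<open>e * e / e\<close>.\<close>
  obtain K d where K: "closed K" "measure \<mu> (- K) < e * e" and "d > 0"
    and sep: "\<forall>x\<in>K. \<forall>y\<in>K. dist x y < d \<longrightarrow> cell P x = cell P y"
    by (rule partition_core[OF X bp P ee])
  \<comment> \<open>Below half of \<open>d\<close>, so that two distances to a common value of
    \<open>y\<close> add up to less than \<open>d\<close>.\<close>
  define e' where "e' = min e (d / 3)"
  have e': "0 < e'" "e' < 1" "e' \<le> e" "2 * e' < d" using e \<open>d > 0\<close> by (auto simp: e'_def)
  obtain y L0 where y: "\<forall>L\<ge>L0.
      1 - e' \<le> measure \<mu> {x. order_match (\<lambda>i j. dist ((T ^^ i) x) (y j) \<le> e') L ((1 - e') * real L)}"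
    using near[OF e'(1,2)] by (elim exE)
  show "\<exists>L. \<forall>n\<ge>L. \<exists>A\<subseteq>join_words T P n.
     measure \<mu> (\<Union>w\<in>A. atom_of T w) > 1 - \<epsilon> \<and> (\<forall>u\<in>A. \<forall>w\<in>A. edit_distance u w < \<epsilon>)"
  proof (rule exI[of _ "Suc L0"], intro allI impI)
    fix n assume "Suc L0 \<le> n"
    then have n: "n > 0" "n \<ge> L0" by auto
    define F where "F = {x. order_match (\<lambda>i j. dist ((T ^^ i) x) (y j) \<le> e') n ((1 - e') * real n)}"
    define Q where "Q = {x. e * real n \<le> real (card {j. j < n \<and> (T ^^ j) x \<in> - K})}"
    have F: "F \<in> sets borel" unfolding F_def using closed_order_match[OF T] by (rule borel_closed)
    have K': "- K \<in> sets borel" using K(1) by auto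
    note Q = measure_many_visits_le[OF \<mu> T K' e(1) n(1), folded Q_def]
    have "measure \<mu> (- K) / e \<le> e" using K(2) e by (simp add: pos_divide_le_eq)
    then have "measure \<mu> Q \<le> e" using Q(1) by linarith
    moreover have "1 - e' \<le> measure \<mu> F" unfolding F_def by (rule y[rule_format, OF n(2)])
    moreover have "measure \<mu> F \<le> measure \<mu> (F - Q) + measure \<mu> Q"
      using measure_Un_le[of "F - Q" \<mu> Q] finite_measure_mono[of F "F - Q \<union> Q"] F Q(2) sets by auto
    ultimately have mFQ: "1 - 2 * e \<le> measure \<mu> (F - Q)" using e' by linarith
    define A where "A = word_at T P n ` (F - Q)"
    have AJ: "A \<subseteq> join_words T P n" using word_at_in_join_words[OF part] by (auto simp: A_def)
    have finA: "finite A" using AJ finite_join_words(1)[OF finP] by (rule finite_subset)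
    have "F - Q \<subseteq> (\<Union>w\<in>A. atom_of T w)" using word_at_in_join_words[OF part] by (auto simp: A_def)
    moreover have "(\<Union>w\<in>A. atom_of T w) \<in> sets \<mu>"
      using finA AJ atom_of_sets[OF T PB] sets by (intro sets.finite_UN) (auto simp: join_words_def)
    ultimately have "measure \<mu> (F - Q) \<le> measure \<mu> (\<Union>w\<in>A. atom_of T w)" by (rule finite_measure_mono)
    then have mA: "measure \<mu> (\<Union>w\<in>A. atom_of T w) > 1 - \<epsilon>" using mFQ e by linarith
    have "edit_distance (word_at T P n x) (word_at T P n x') < \<epsilon>" if x: "x \<in> F - Q" "x' \<in> F - Q" for x x'
    proof -
      have Fx: "order_match (\<lambda>i j. dist ((T ^^ i) x) (y j) \<le> e') n ((1 - e') * real n)"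
        "order_match (\<lambda>j i. dist ((T ^^ i) x') (y j) \<le> e') n ((1 - e') * real n)"
        using x order_match_converse by (auto simp: F_def)
      have "order_match (\<lambda>i j. dist ((T ^^ i) x) ((T ^^ j) x') < d) n
          ((1 - e') * real n + (1 - e') * real n - real n)"
      proof (rule order_match_compose[OF Fx])
        fix i j l assume "dist ((T ^^ i) x) (y j) \<le> e'" "dist ((T ^^ l) x') (y j) \<le> e'"
        then show "dist ((T ^^ i) x) ((T ^^ l) x') < d"
          using dist_triangle2[of "(T ^^ i) x" "(T ^^ l) x'" "y j"] e' by linarith
      qed
      moreover have Qx: "real (card {i. i < n \<and> \<not> (T ^^ i) v \<in> K}) \<le> e * real n" if "v \<in> F - Q" for v
        using that by (simp add: Q_def)
      ultimately have "order_match (\<lambda>i j. (dist ((T ^^ i) x) ((T ^^ j) x') < d \<and> (T ^^ i) x \<in> K) \<and> (T ^^ j) x' \<in> K) n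
          ((1 - e') * real n + (1 - e') * real n - real n - e * real n - e * real n)"
        using x by (intro order_match_restrict_right order_match_restrict_left) auto
      then have "order_match (\<lambda>i j. word_at T P n x ! i = word_at T P n x' ! j) n ((1 - 4 * e) * real n)"
      proof (rule order_match_mono)
        have "e' * real n \<le> e * real n" using e' by (intro mult_right_mono) auto
        then show "(1 - 4 * e) * real n \<le> (1 - e') * real n + (1 - e') * real n - real n - e * real n - e * real n"
          by (simp add: algebra_simps)
      qed (use sep in auto)
      then have "edit_distance (word_at T P n x) (word_at T P n x') \<le> 1 - (1 - 4 * e) * real n / real n"
        by (rule edit_distance_le_order_match) (use n in auto)
      also have "\<dots> = 4 * e" using n by simp
      finally show ?thesis using e by linarith
    qed
    then show "\<exists>A\<subseteq>join_words T P n. measure \<mu> (\<Union>w\<in>A. atom_of T w) > 1 - \<epsilon> \<and>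
        (\<forall>u\<in>A. \<forall>w\<in>A. edit_distance u w < \<epsilon>)"
      using AJ mA by (intro exI[of _ A]) (auto simp: A_def)
  qed
qed

theorem theorem9p1:
  fixes T :: "'a::metric_space \<Rightarrow> 'a"
    and M :: "nat \<Rightarrow> 'a measure"
    and \<mu> :: "'a measure"
  assumes "compact (UNIV :: 'a set)"
    and "continuous_on UNIV T"
    and "\<And>n. invariant_measure T (M n)"
    and "(\<forall>n. periodic_measure T (M n)) \<or> (\<forall>n. loosely_kronecker T (M n))"
    and "fk_limit T M \<mu>"
    and "aperiodic_measure T \<mu>"
  shows "loosely_kronecker T \<mu>"
proof -
  note X = assms(1) and T = assms(2)
  have \<mu>: "invariant_measure T \<mu>" using assms(5) by (simp add: fk_limit_def)
  then have bp: "borel_prob \<mu>" by (simp add: invariant_measure_def)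
  obtain x z where x: "\<And>n. generic_point T (x n) (M n)" and z: "quasi_orbit T z" "generic_seq z \<mu>"
    and lim: "(\<lambda>n. fk z (trajectory T (x n))) \<longlonglongrightarrow> 0"
    using assms(5) by (auto simp: fk_limit_def)
  have approx: "periodically_approximable T (M n)" for n
    using assms(4) periodic_measure_approximable[OF T] loosely_kronecker_approximable[OF X T] by blast
  have near: "\<exists>(y :: nat \<Rightarrow> 'a) p. p > 0 \<and> (\<forall>j. y (j + p) = y j) \<and>
      (\<forall>\<^sub>F N in sequentially. order_match (\<lambda>i j. dist (z i) (y j) < e) N ((1 - e) * real N))"
    if e: "0 < e" "e < 1" for e
  proof -
    obtain y and p :: nat where "p > 0" "\<forall>j. y (j + p) = y j"
      "\<forall>\<^sub>F N in sequentially. order_match (\<lambda>i j. dist (z i) (y j) < e) N ((1 - e) * real N)"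
      using fk_limit_near_periodic[OF approx x lim e] .
    then show ?thesis by (intro exI conjI)
  qed
  have word: "\<exists>(y :: nat \<Rightarrow> 'a) L0. \<forall>L\<ge>L0.
      1 - e \<le> measure \<mu> {x. order_match (\<lambda>i j. dist ((T ^^ i) x) (y j) \<le> e) L ((1 - e) * real L)}"
    if e: "0 < e" "e < 1" for e
  proof -
    obtain y L0 where "\<forall>L\<ge>L0.
        1 - e \<le> measure \<mu> {x. order_match (\<lambda>i j. dist ((T ^^ i) x) (y j) \<le> e) L ((1 - e) * real L)}"
      using measure_near_word[OF T z near e] .
    then show ?thesis by (intro exI)
  qed
  have alike: "eventually_alike T \<mu> P" if "finite_borel_partition P" for P :: "'a set set"
    by (rule eventually_alike_if_near_words[OF X T \<mu> word that])
  show ?thesis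
    unfolding loosely_kronecker_def
  proof (intro conjI allI impI)
    show "ergodic_measure T \<mu>" by (rule ergodic_measure_if_alike[OF \<mu> alike])
    show "ks_entropy T \<mu> = 0" by (rule ks_entropy_eq_0[OF bp T alike])
  next
    fix P :: "'a set set" and \<epsilon> :: real
    assume "finite_borel_partition P" "\<epsilon> > 0"
    then obtain L where L: "\<And>n. n \<ge> L \<Longrightarrow> \<exists>A\<subseteq>join_words T P n.
        measure \<mu> (\<Union>w\<in>A. atom_of T w) > 1 - \<epsilon> \<and> (\<forall>u\<in>A. \<forall>w\<in>A. edit_distance u w < \<epsilon>)"
      using alike unfolding eventually_alike_def by blast
    show "\<exists>n>0. \<exists>A\<subseteq>join_words T P n.
        measure \<mu> (\<Union>w\<in>A. atom_of T w) > 1 - \<epsilon> \<and> (\<forall>u\<in>A. \<forall>w\<in>A. edit_distance u w < \<epsilon>)"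
      \<comment> \<open>\<open>Suc L\<close> instead of \<open>L\<close> guarantees a positive
        length.\<close>
      using L[of "Suc L"] by (intro exI[of _ "Suc L"]) auto
  qed
qed

end
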